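(* Let $k>0$ and let $\phi$ be a bounded (measurable) function such that the map $\tilde\phi:\theta\mapsto E_{Q^\theta}[\phi(X)]$ is twice differentiable on $\Theta$. Then for all $P\in\mathcal{Q}$, $$\mathcal{E}^{k,1}_{\mathcal{Q}|\mathbf{x}_N}(\phi(X))=E_{\hat\theta_N}[\phi(X)]+\frac{k}{2N}V(\phi,\hat\theta_N)+O_P(N^{-3/2}).$$
   Context: Setting. $\Theta\subseteq\mathbb{R}^d$ is open and $\mathcal{Q}=\{Q^\theta:\theta\in\Theta\}$ is an exponential family in natural parameters: under $Q^\theta$ the random variables $X,X_1,X_2,\dots$ are iid with density $$f(x;Q^\theta)=h(x)\exp\{\langle\theta,T(x)\rangle-A(\theta)\},$$ where $T$ is an $\mathbb{R}^d$-valued sufficient statistic, $h$ a normalization function and $A$ the log-partition function (convex and smooth). $\mathcal{Q}$ consists of all such measures with $\theta\in\Theta$; $\theta_Q$ denotes the parameter of $Q$, and $E_\theta=E_{Q^\theta}$. Write $\mathbf{x}_N=(X_1,\dots,X_N)$, $L(Q|\mathbf{x}_N)=\prod_{n=1}^N f(X_n;Q)$. Standing assumptions: (a) the Hessian $\mathfrak{I}_\theta=\partial^2A(\theta)$ is strictly positive definite at every $\theta\in\Theta$; (b) for every $Q\in\mathcal{Q}$, with $Q$-probability tending to $1$ as $N\to\infty$ a maximizer $\hat Q_N\in\mathcal{Q}$ of the likelihood $L(\cdot|\mathbf{x}_N)$ exists, and $\hat\theta_N=\theta_{\hat Q_N}\to\theta_Q$ in $Q$-probability. Divergence: $\alpha_{\mathcal{Q}|\mathbf{x}_N}(Q)=-\log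 L(Q|\mathbf{x}_N)+\sup_{\tilde Q\in\mathcal{Q}}\log L(\tilde Q|\mathbf{x}_N)$. DR-expectation: $\mathcal{E}^{k,1}_{\mathcal{Q}|\mathbf{x}_N}(\xi)=\sup_{Q\in\mathcal{Q}}\{E_Q[\xi|\mathbf{x}_N]-\frac1k\alpha_{\mathcal{Q}|\mathbf{x}_N}(Q)\}$; for $\xi=\phi(X)$, $E_Q[\xi|\mathbf{x}_N]=E_Q[\phi(X)]$ by independence. $V(\phi,\hat\theta)=(\partial\tilde\phi|_{\hat\theta})^\top\,\mathfrak{I}_{\hat\theta}^{-1}\,(\partial\tilde\phi|_{\hat\theta})$, where $\partial\tilde\phi$ is the gradient of $\tilde\phi$. $Y_N=O_P(g(N))$ means $\lim_{M\to\infty}\limsup_{N\to\infty}P(|Y_N/g(N)|>M)=0$ (events on which the MLE fails to exist have $P$-probability tending to $0$ and are disregarded). *)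

theory Defs
  imports "HOL-Probability.Probability"
begin

section \<open>Gradients and Hessians\<close>

definition gradient :: "('a::real_inner \<Rightarrow> real) \<Rightarrow> 'a \<Rightarrow> 'a"
  where "gradient f x = (THE D. GDERIV f x :> D)"

definition hessian :: "(real ^ 'd \<Rightarrow> real) \<Rightarrow> real ^ 'd \<Rightarrow> real ^ 'd ^ 'd"
  where "hessian f x = jacobian (gradient f) (at x)"

definition twice_differentiable_on :: "(real ^ 'd \<Rightarrow> real) \<Rightarrow> (real ^ 'd) set \<Rightarrow> bool"
  where "twice_differentiable_on f S \<longleftrightarrow>
    (\<forall>x\<in>S. f differentiable (at x)) \<and> (\<forall>x\<in>S. gradient f differentiable (at x))"

definition positive_definite :: "real ^ 'd ^ 'd \<Rightarrow> bool"
  where "positive_definite B \<longleftrightarrow> (\<forall>v. v \<noteq> 0 \<longrightarrow> v \<bullet> (B *v v) > 0)"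

section \<open>Exponential families in natural parameters\<close>

text \<open>
  Densities are taken with respect to an arbitrary reference measure \<open>\<mu>\<close>. The integral in the
  log-partition function is finite and positive on the parameter set by the locale assumptions
  below; convexity and smoothness of the log-partition function are consequences of the
  definition and are not assumed.
\<close>

definition log_partition ::
    "'x measure \<Rightarrow> ('x \<Rightarrow> real) \<Rightarrow> ('x \<Rightarrow> real ^ 'd) \<Rightarrow> real ^ 'd \<Rightarrow> real"
  where "log_partition \<mu> h T \<theta> = ln (\<integral>x. h x * exp (\<theta> \<bullet> T x) \<partial>\<mu>)"

definition ef_density ::
    "'x measure \<Rightarrow> ('x \<Rightarrow> real) \<Rightarrow> ('x \<Rightarrow> real ^ 'd) \<Rightarrow> real ^ 'd \<Rightarrow> 'x \<Rightarrow> real"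
  where "ef_density \<mu> h T \<theta> x = h x * exp (\<theta> \<bullet> T x - log_partition \<mu> h T \<theta>)"

locale exponential_family =
  fixes \<Theta> :: "(real ^ 'd) set"
    and \<mu> :: "'x measure"
    and h :: "'x \<Rightarrow> real"
    and T :: "'x \<Rightarrow> real ^ 'd"
  assumes open_params: "open \<Theta>"
    and h_measurable [measurable]: "h \<in> borel_measurable \<mu>"
    and h_nonneg: "x \<in> space \<mu> \<Longrightarrow> 0 \<le> h x"
    and T_measurable [measurable]: "T \<in> borel_measurable \<mu>"
    and partition_integrable: "\<theta> \<in> \<Theta> \<Longrightarrow> integrable \<mu> (\<lambda>x. h x * exp (\<theta> \<bullet> T x))"
    and partition_pos: "\<theta> \<in> \<Theta> \<Longrightarrow> 0 < (\<integral>x. h x * exp (\<theta> \<bullet> T x) \<partial>\<mu>)"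

text \<open>
  All measures of the family live on one measurable space \<open>\<Omega>\<close> carrying the random variable \<open>X\<close>
  and the observations. Observations are indexed from 0: \<open>Xs n\<close> is $X_{n+1}$, so that
  $(X_1,\dots,X_N)$ is \<open>Xs 0, \<dots>, Xs (N - 1)\<close>. The sequence \<open>case_nat X Xs\<close> is
  $X, X_1, X_2, \dots$.
\<close>

locale exponential_family_sample = exponential_family \<Theta> \<mu> h T
  for \<Theta> :: "(real ^ 'd) set"
    and \<mu> :: "'x measure"
    and h :: "'x \<Rightarrow> real"
    and T :: "'x \<Rightarrow> real ^ 'd" +
  fixes \<Omega> :: "'w measure"
    and Q :: "real ^ 'd \<Rightarrow> 'w measure"
    and X :: "'w \<Rightarrow> 'x"
    and Xs :: "nat \<Rightarrow> 'w \<Rightarrow> 'x"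
  assumes sets_Q: "\<theta> \<in> \<Theta> \<Longrightarrow> sets (Q \<theta>) = sets \<Omega>"
    and prob_space_Q: "\<theta> \<in> \<Theta> \<Longrightarrow> prob_space (Q \<theta>)"
    and X_distributed:
      "\<theta> \<in> \<Theta> \<Longrightarrow> distributed (Q \<theta>) \<mu> X (\<lambda>x. ennreal (ef_density \<mu> h T \<theta> x))"
    and Xs_distributed:
      "\<theta> \<in> \<Theta> \<Longrightarrow> distributed (Q \<theta>) \<mu> (Xs n) (\<lambda>x. ennreal (ef_density \<mu> h T \<theta> x))"
    and indep:
      "\<theta> \<in> \<Theta> \<Longrightarrow> prob_space.indep_vars (Q \<theta>) (\<lambda>_. \<mu>) (case_nat X Xs) UNIV"

section \<open>Likelihood, divergence and the DR-expectation\<close>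

definition likelihood ::
    "'x measure \<Rightarrow> ('x \<Rightarrow> real) \<Rightarrow> ('x \<Rightarrow> real ^ 'd) \<Rightarrow> (nat \<Rightarrow> 'w \<Rightarrow> 'x) \<Rightarrow>
      nat \<Rightarrow> real ^ 'd \<Rightarrow> 'w \<Rightarrow> real"
  where "likelihood \<mu> h T Xs N \<theta> \<omega> = (\<Prod>n<N. ef_density \<mu> h T \<theta> (Xs n \<omega>))"

definition is_mle ::
    "(real ^ 'd) set \<Rightarrow> 'x measure \<Rightarrow> ('x \<Rightarrow> real) \<Rightarrow> ('x \<Rightarrow> real ^ 'd) \<Rightarrow> (nat \<Rightarrow> 'w \<Rightarrow> 'x) \<Rightarrow>
      nat \<Rightarrow> 'w \<Rightarrow> real ^ 'd \<Rightarrow> bool"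
  where "is_mle \<Theta> \<mu> h T Xs N \<omega> \<theta> \<longleftrightarrow>
    \<theta> \<in> \<Theta> \<and> (\<forall>\<theta>'\<in>\<Theta>. likelihood \<mu> h T Xs N \<theta>' \<omega> \<le> likelihood \<mu> h T Xs N \<theta> \<omega>)"

text \<open>
  The suprema below are real-valued, hence meaningful only where the likelihood is positive and
  bounded over the family. Samples with zero likelihood form a null event under every member of
  the family, and the likelihood is bounded whenever a maximizer exists.
\<close>

definition divergence ::
    "(real ^ 'd) set \<Rightarrow> 'x measure \<Rightarrow> ('x \<Rightarrow> real) \<Rightarrow> ('x \<Rightarrow> real ^ 'd) \<Rightarrow> (nat \<Rightarrow> 'w \<Rightarrow> 'x) \<Rightarrow>
      nat \<Rightarrow> real ^ 'd \<Rightarrow> 'w \<Rightarrow> real"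
  where "divergence \<Theta> \<mu> h T Xs N \<theta> \<omega> =
    - ln (likelihood \<mu> h T Xs N \<theta> \<omega>) + (SUP \<theta>'\<in>\<Theta>. ln (likelihood \<mu> h T Xs N \<theta>' \<omega>))"

text \<open>
  Conditional expectations are determined only almost surely, so the supremum over an uncountable
  family depends on the versions chosen. The argument \<open>ce\<close> supplies them: \<open>ce \<theta>\<close> is a version of
  the conditional expectation of $\xi$ given the first \<open>N\<close> observations under \<open>Q \<theta>\<close>. For
  $\xi = \phi(X)$ the version is the constant \<open>mean Q X \<phi> \<theta>\<close>; lemma \<open>cond_exp_mean\<close> justifies
  this by independence.
\<close>

definition dr_expectation ::
    "(real ^ 'd) set \<Rightarrow> 'x measure \<Rightarrow> ('x \<Rightarrow> real) \<Rightarrow> ('x \<Rightarrow> real ^ 'd) \<Rightarrow> (nat \<Rightarrow> 'w \<Rightarrow> 'x) \<Rightarrow>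
      real \<Rightarrow> nat \<Rightarrow> (real ^ 'd \<Rightarrow> 'w \<Rightarrow> real) \<Rightarrow> 'w \<Rightarrow> real"
  where "dr_expectation \<Theta> \<mu> h T Xs k N ce \<omega> =
    (SUP \<theta>\<in>\<Theta>. ce \<theta> \<omega> - 1 / k * divergence \<Theta> \<mu> h T Xs N \<theta> \<omega>)"

definition mean ::
    "(real ^ 'd \<Rightarrow> 'w measure) \<Rightarrow> ('w \<Rightarrow> 'x) \<Rightarrow> ('x \<Rightarrow> real) \<Rightarrow> real ^ 'd \<Rightarrow> real"
  where "mean Q X \<phi> \<theta> = (\<integral>\<omega>. \<phi> (X \<omega>) \<partial>Q \<theta>)"

definition asymp_var ::
    "'x measure \<Rightarrow> ('x \<Rightarrow> real) \<Rightarrow> ('x \<Rightarrow> real ^ 'd) \<Rightarrow>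
      (real ^ 'd \<Rightarrow> 'w measure) \<Rightarrow> ('w \<Rightarrow> 'x) \<Rightarrow> ('x \<Rightarrow> real) \<Rightarrow> real ^ 'd \<Rightarrow> real"
  where "asymp_var \<mu> h T Q X \<phi> \<theta> =
    gradient (mean Q X \<phi>) \<theta> \<bullet>
      (matrix_inv (hessian (log_partition \<mu> h T) \<theta>) *v gradient (mean Q X \<phi>) \<theta>)"

section \<open>Convergence and boundedness in probability\<close>

text \<open>
  Probabilities of events that involve suprema over the uncountable parameter set, or a selected
  maximizer, are taken in the sense of the outer measure, which agrees with the measure on
  measurable sets. In this way no measurability of the estimator has to be assumed, and no event
  gets probability 0 merely by failing to be measurable.
\<close>

definition whp :: "'w measure \<Rightarrow> (nat \<Rightarrow> 'w \<Rightarrow> bool) \<Rightarrow> bool"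
  where "whp P E \<longleftrightarrow> (\<lambda>N. outer_measure_of P {\<omega> \<in> space P. \<not> E N \<omega>}) \<longlonglongrightarrow> 0"

definition tendsto_in_prob ::
    "'w measure \<Rightarrow> (nat \<Rightarrow> 'w \<Rightarrow> 'a::metric_space) \<Rightarrow> 'a \<Rightarrow> bool"
  where "tendsto_in_prob P Y l \<longleftrightarrow>
    (\<forall>\<epsilon>>0. (\<lambda>N. outer_measure_of P {\<omega> \<in> space P. dist (Y N \<omega>) l > \<epsilon>}) \<longlonglongrightarrow> 0)"

text \<open>
  Changing the sequence on events whose probability tends to 0 does not affect the limit superior,
  so arbitrary values on the events without a maximum likelihood estimator are harmless.
\<close>

definition big_O_prob :: "'w measure \<Rightarrow> (nat \<Rightarrow> 'w \<Rightarrow> real) \<Rightarrow> (nat \<Rightarrow> real) \<Rightarrow> bool"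
  where "big_O_prob P Y g \<longleftrightarrow>
    ((\<lambda>M::real. limsup (\<lambda>N. outer_measure_of P {\<omega> \<in> space P. \<bar>Y N \<omega> / g N\<bar> > M}))
      \<longlongrightarrow> 0) at_top"

section \<open>Conditional expectations given the observations\<close>

definition obs_algebra :: "'x measure \<Rightarrow> 'w measure \<Rightarrow> (nat \<Rightarrow> 'w \<Rightarrow> 'x) \<Rightarrow> nat \<Rightarrow> 'w measure"
  where "obs_algebra \<mu> P Xs N =
    vimage_algebra (space P) (\<lambda>\<omega>. \<lambda>n\<in>{..<N}. Xs n \<omega>) (\<Pi>\<^sub>M n\<in>{..<N}. \<mu>)"

context exponential_family_sample
begin

lemma cond_exp_mean:
  assumes \<theta>: "\<theta> \<in> \<Theta>"
    and \<phi>: "\<phi> \<in> borel_measurable \<mu>" "bounded (\<phi> ` space \<mu>)"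
  shows "AE \<omega> in Q \<theta>. real_cond_exp (Q \<theta>) (obs_algebra \<mu> (Q \<theta>) Xs N) (\<lambda>\<omega>. \<phi> (X \<omega>)) \<omega>
    = mean Q X \<phi> \<theta>"
proof -
  interpret P: prob_space "Q \<theta>" by (rule prob_space_Q[OF \<theta>])
  let ?PN = "\<Pi>\<^sub>M n\<in>{..<N}. \<mu>"
  let ?x = "\<lambda>\<omega>. \<lambda>n\<in>{..<N}. Xs n \<omega>"
  let ?F = "obs_algebra \<mu> (Q \<theta>) Xs N"
  note [measurable] = \<phi>(1)
  have X[measurable]: "X \<in> measurable (Q \<theta>) \<mu>"
    using X_distributed[OF \<theta>] by (simp add: distributed_def)
  have Xs[measurable]: "Xs n \<in> measurable (Q \<theta>) \<mu>" for n
    using Xs_distributed[OF \<theta>, of n] by (simp add: distributed_def)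
  have x[measurable]: "?x \<in> measurable (Q \<theta>) ?PN"
    by (intro measurable_restrict) simp
  obtain b where b: "\<And>y. y \<in> space \<mu> \<Longrightarrow> \<bar>\<phi> y\<bar> \<le> b"
    using \<phi>(2) unfolding bounded_iff by auto
  have int: "integrable (Q \<theta>) (\<lambda>\<omega>. \<phi> (X \<omega>))"
    by (rule P.integrable_const_bound[where B = b])
       (auto intro!: AE_I2 b measurable_space[OF X])
  have sub: "subalgebra (Q \<theta>) ?F"
    unfolding subalgebra_def obs_algebra_def
    using measurable_iff_sets[of ?x "Q \<theta>" ?PN] x by auto
  interpret sigma_finite_subalgebra "Q \<theta>" ?F
    by (rule finite_measure_subalgebra_is_sigma_finite[OF finite_measure_subalgebra.intro])
       (auto intro: P.finite_measure_axioms simp: finite_measure_subalgebra_axioms_def sub)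
  have ind: "P.indep_var (PiM {0} (\<lambda>_. \<mu>)) (\<lambda>\<omega>. restrict (\<lambda>i. case_nat X Xs i \<omega>) {0})
      (PiM {1..N} (\<lambda>_. \<mu>)) (\<lambda>\<omega>. restrict (\<lambda>i. case_nat X Xs i \<omega>) {1..N})"
    by (rule P.indep_var_restrict[OF indep[OF \<theta>]]) auto
  show ?thesis
  proof (rule real_cond_exp_charact)
    fix A assume "A \<in> sets ?F"
    then obtain B where B[measurable]: "B \<in> sets ?PN" and A: "A = ?x -` B \<inter> space (Q \<theta>)"
      using sets_vimage_algebra2[of ?x "space (Q \<theta>)" ?PN] measurable_space[OF x]
      unfolding obs_algebra_def by auto
    have "P.indep_var borel ((\<lambda>f. \<phi> (f 0)) \<circ> (\<lambda>\<omega>. restrict (\<lambda>i. case_nat X Xs i \<omega>) {0}))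
        borel ((\<lambda>f. indicator B (\<lambda>n\<in>{..<N}. f (Suc n)) :: real)
          \<circ> (\<lambda>\<omega>. restrict (\<lambda>i. case_nat X Xs i \<omega>) {1..N}))"
      by (rule P.indep_var_compose[OF ind]) measurable
    moreover have "(\<lambda>n\<in>{..<N}. restrict (\<lambda>i. case_nat X Xs i \<omega>) {1..N} (Suc n)) = ?x \<omega>" for \<omega>
      by (auto simp: fun_eq_iff restrict_def)
    ultimately have i: "P.indep_var borel (\<lambda>\<omega>. \<phi> (X \<omega>)) borel (\<lambda>\<omega>. indicator B (?x \<omega>) :: real)"
      unfolding comp_def by simp
    have i2: "integrable (Q \<theta>) (\<lambda>\<omega>. indicator B (?x \<omega>) :: real)"
      by (rule P.integrable_const_bound[where B = 1]) (auto simp: indicator_def)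
    have ind_eq: "indicator A \<omega> = (indicator B (?x \<omega>) :: real)" if "\<omega> \<in> space (Q \<theta>)" for \<omega>
      using that by (auto simp: A indicator_def)
    have "(\<integral>\<omega>\<in>A. \<phi> (X \<omega>) \<partial>Q \<theta>) = (\<integral>\<omega>. \<phi> (X \<omega>) * indicator B (?x \<omega>) \<partial>Q \<theta>)"
      unfolding set_lebesgue_integral_def
      by (intro Bochner_Integration.integral_cong) (auto simp: ind_eq simp del: restrict_apply)
    also have "\<dots> = mean Q X \<phi> \<theta> * (\<integral>\<omega>. indicator B (?x \<omega>) \<partial>Q \<theta>)"
      unfolding mean_def by (rule P.indep_var_lebesgue_integral[OF i int i2])
    also have "\<dots> = (\<integral>\<omega>\<in>A. mean Q X \<phi> \<theta> \<partial>Q \<theta>)"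
      unfolding set_lebesgue_integral_def
      by (subst integral_mult_right_zero[symmetric], intro Bochner_Integration.integral_cong)
         (auto simp: ind_eq simp del: restrict_apply)
    finally show "(\<integral>\<omega>\<in>A. \<phi> (X \<omega>) \<partial>Q \<theta>) = (\<integral>\<omega>\<in>A. mean Q X \<phi> \<theta> \<partial>Q \<theta>)" .
  qed (auto intro: int)
qed

end

end

theory Submission
  imports Defs
begin

text \<open>
  Write $\hat\theta$ for the maximum likelihood estimator, $m(\theta) = E_\theta[\phi(X)]$ and
  $D(\theta) = A(\theta) - A(\hat\theta) - \langle \partial A(\hat\theta), \theta - \hat\theta\rangle$.
  The first order condition at $\hat\theta$ replaces the sample mean of $T$ by
  $\partial A(\hat\theta)$, so the divergence of $\theta$ is $N D(\theta)$ and the DR-expectation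
  is the supremum of $m(\theta) - (N/k) D(\theta)$. Both $m$ and $A$ are smooth, as moments of an
  exponential family, with Taylor constants that are uniform near the true parameter. The
  penalty confines near-maximizers to distance $O(1/N)$ from $\hat\theta$ (far away by convexity
  of $A$, nearby by positive definiteness of its Hessian). There the objective is a concave quadratic
  up to $O(N^{-2})$, and completing the square gives the term $k V / (2N)$. The bound is
  deterministic on the event that $\hat\theta$ exists and is close to the true parameter, whose
  probability tends to 1.
\<close>

section \<open>Moments of an exponential family\<close>

text \<open>The expansion is centred at the random point \<theta>hat, so expansions at
  \<open>\<theta>\<^sub>P\<close> alone would not do: each constant must serve all centres in a ball
  around the true parameter. Hence the passage through a class of functions closed under partial
  derivatives: members are continuous, so bounded on compact sets; applied to the partials this
  gives Lipschitz constants, and from these come Taylor constants valid at every centre of a compact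
  convex set. A second obstacle is that \<Theta> may fail to be convex. The segment from the
  estimator to a distant competitor may leave \<Theta>, but convexity of A is used only at the one
  point where this segment crosses a small sphere inside \<Theta>. The scale 1/N is where the at
  most linear gain of m is overtaken by N/k times a quadratic. At that scale the quadratic error of
  m and N/k times the cubic error of D are both of order N^(-2), which is stronger than the rate
  N^(-3/2) of the claim.\<close>

lemma exp_remainder_bound: "\<bar>exp s - 1 - s\<bar> \<le> s\<^sup>2 * exp \<bar>s\<bar>" for s :: real
proof -
  obtain t where t: "\<bar>t\<bar> \<le> \<bar>s\<bar>" "exp s = (\<Sum>m<2. s ^ m / fact m) + exp t / fact 2 * s ^ 2"
    using Maclaurin_exp_le[of s 2] by blast
  have "exp t \<le> exp \<bar>s\<bar>" using t(1) by simp
  moreover have "exp t / 2 \<le> exp t" by simp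
  ultimately have "exp t / 2 \<le> exp \<bar>s\<bar>" by linarith
  hence "exp t / 2 * s\<^sup>2 \<le> exp \<bar>s\<bar> * s\<^sup>2" by (rule mult_right_mono) simp
  moreover have "exp s - 1 - s = exp t / 2 * s\<^sup>2"
    using t(2) by (simp add: numeral_2_eq_2)
  moreover have "0 \<le> exp t / 2 * s\<^sup>2" by simp
  ultimately show ?thesis by (simp only: abs_of_nonneg mult.commute)
qed

text \<open>Trades a factor t for exponential growth of arbitrarily small rate a, at the price
  1/a.\<close>

lemma le_exp_scaled: "t \<le> 1 / a * exp (a * t)" if "a > 0" for a t :: real
proof -
  have "a * t \<le> exp (a * t)" using exp_ge_add_one_self[of "a * t"] by linarith
  thus ?thesis using that by (simp add: field_simps)
qed

text \<open>Integrability is given only for exponents linear in \<open>T x\<close>, so the norm has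
  to be replaced by linear forms. Comparing it with the largest coordinate through the l1 norm costs
  the factor \<open>CARD('d)\<close>. Both signs appear because the sign of that coordinate is
  unknown, and the sum because its index is.\<close>

lemma exp_norm_le_sum_axes:
  fixes v :: "real ^ 'd"
  assumes "\<delta> \<ge> 0"
  shows "exp (\<delta> * norm v) \<le> (\<Sum>i\<in>UNIV. exp (real CARD('d) * \<delta> * v $ i) + exp (- (real CARD('d) * \<delta>) * v $ i))"
proof -
  obtain j where j: "\<And>i. \<bar>v $ i\<bar> \<le> \<bar>v $ j\<bar>"
  proof -
    have "Max (range (\<lambda>i. \<bar>v $ i\<bar>)) \<in> range (\<lambda>i. \<bar>v $ i\<bar>)" by (rule Max_in) auto
    then obtain j where "Max (range (\<lambda>i. \<bar>v $ i\<bar>)) = \<bar>v $ j\<bar>" by (rule rangeE)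
    hence "\<bar>v $ i\<bar> \<le> \<bar>v $ j\<bar>" for i
      by (metis Max_ge finite_imageI finite_class.finite_UNIV rangeI)
    thus ?thesis by (rule that)
  qed
  have "norm v \<le> (\<Sum>i\<in>UNIV. \<bar>v $ i\<bar>)" by (rule norm_le_l1_cart)
  also have "\<dots> \<le> (\<Sum>i\<in>(UNIV :: 'd set). \<bar>v $ j\<bar>)" by (rule sum_mono) (rule j)
  finally have "\<delta> * norm v \<le> \<delta> * (real CARD('d) * \<bar>v $ j\<bar>)"
    using assms by (intro mult_left_mono) simp_all
  hence "exp (\<delta> * norm v) \<le> exp (real CARD('d) * \<delta> * \<bar>v $ j\<bar>)" by (simp add: mult_ac)
  also have "\<dots> \<le> exp (real CARD('d) * \<delta> * v $ j) + exp (- (real CARD('d) * \<delta>) * v $ j)"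
    by (cases "v $ j \<ge> 0") (simp_all add: add_increasing add_increasing2)
  also have "\<dots> \<le> (\<Sum>i\<in>UNIV. exp (real CARD('d) * \<delta> * v $ i) + exp (- (real CARD('d) * \<delta>) * v $ i))"
    by (rule member_le_sum) (auto intro: add_nonneg_nonneg)
  finally show ?thesis .
qed

lemma has_derivative_quadratic_remainder:
  fixes f :: "'a::real_normed_vector \<Rightarrow> 'b::real_normed_vector"
  assumes D: "bounded_linear D" and "\<epsilon> > 0"
    and bound: "\<And>u. norm u \<le> \<epsilon> \<Longrightarrow> norm (f (x + u) - f x - D u) \<le> C * (norm u)\<^sup>2"
  shows "(f has_derivative D) (at x)"
  unfolding has_derivative_at_alt
proof (intro conjI allI impI D)
  fix e :: real assume e: "e > 0"
  \<comment> \<open>\<open>\<bar>C\<bar> + 1\<close> covers a negative C and avoids division by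
    zero.\<close>
  define d where "d = min \<epsilon> (e / (\<bar>C\<bar> + 1))"
  have "d > 0" using e \<open>\<epsilon> > 0\<close> by (simp add: d_def)
  moreover have "norm (f y - f x - D (y - x)) \<le> e * norm (y - x)" if "norm (y - x) < d" for y
  proof -
    have "norm (y - x) \<le> e / (\<bar>C\<bar> + 1)" using that by (simp add: d_def)
    hence "(\<bar>C\<bar> + 1) * norm (y - x) \<le> e" by (simp add: field_simps)
    moreover have "C * norm (y - x) \<le> (\<bar>C\<bar> + 1) * norm (y - x)" by (intro mult_right_mono) auto
    ultimately have "C * norm (y - x) \<le> e" by linarith
    hence "C * norm (y - x) * norm (y - x) \<le> e * norm (y - x)" by (intro mult_right_mono) auto
    thus ?thesis using bound[of "y - x"] that by (simp add: d_def power2_eq_square mult_ac)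
  qed
  ultimately show "\<exists>d>0. \<forall>y. norm (y - x) < d \<longrightarrow> norm (f y - f x - D (y - x)) \<le> e * norm (y - x)"
    by blast
qed

section \<open>Exponential slack and differentiation under the integral\<close>

context exponential_family
begin

lemma T_component_measurable [measurable]: "(\<lambda>x. T x $ i) \<in> borel_measurable \<mu>"
  by (rule measurable_compose[OF T_measurable])
    (intro borel_measurable_continuous_onI continuous_intros)

text \<open>
  The exponential slack absorbs any power of \<open>norm (T x)\<close>. It makes the class stable under
  multiplication by the components of \<open>T\<close> and justifies differentiation under the integral.
\<close>

definition tame :: "('x \<Rightarrow> real) set"
  where "tame = {\<psi> \<in> borel_measurable \<mu>. \<forall>\<theta>\<in>\<Theta>. \<exists>\<delta>>0.
    integrable \<mu> (\<lambda>x. \<psi> x * (h x * exp (\<theta> \<bullet> T x)) * exp (\<delta> * norm (T x)))}"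

text \<open>Left unnormalized, so that a partial derivative is again a moment, with one more
  component of T as a factor; expectations are quotients by the moment of 1.\<close>

definition moment :: "('x \<Rightarrow> real) \<Rightarrow> real ^ 'd \<Rightarrow> real"
  where "moment \<psi> \<theta> = (\<integral>x. \<psi> x * (h x * exp (\<theta> \<bullet> T x)) \<partial>\<mu>)"

text \<open>Openness of \<Theta> supplies the slack: the points obtained from \<theta> by moving a
  distance e along the coordinate axes, both ways, stay in \<Theta>, and the sum G of their
  integrable weights dominates the weight at \<theta> times the exponential of the norm.\<close>

lemma bounded_tame:
  assumes [measurable]: "\<psi> \<in> borel_measurable \<mu>" and b: "\<And>x. x \<in> space \<mu> \<Longrightarrow> \<bar>\<psi> x\<bar> \<le> b"
  shows "\<psi> \<in> tame"
  unfolding tame_def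
proof (intro CollectI conjI ballI)
  fix \<theta> assume \<theta>: "\<theta> \<in> \<Theta>"
  obtain e where e: "e > 0" "cball \<theta> e \<subseteq> \<Theta>" using open_params \<theta> open_contains_cball by blast
  \<comment> \<open>Makes the coefficient in \<open>exp_norm_le_sum_axes\<close> exactly the shift
    e.\<close>
  define \<delta> where "\<delta> = e / real CARD('d)"
  have \<delta>: "\<delta> > 0" "real CARD('d) * \<delta> = e" using e by (simp_all add: \<delta>_def)
  define G where "G x = (\<Sum>i\<in>UNIV. h x * exp ((\<theta> + e *\<^sub>R axis i 1) \<bullet> T x) + h x * exp ((\<theta> - e *\<^sub>R axis i 1) \<bullet> T x))"
    for x
  have in_ball: "\<theta> + e *\<^sub>R axis i 1 \<in> \<Theta>" "\<theta> - e *\<^sub>R axis i 1 \<in> \<Theta>" for i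
    using e by (auto intro!: subsetD[OF e(2)] simp: dist_norm norm_axis_1)
  have "integrable \<mu> G" unfolding G_def
    by (intro Bochner_Integration.integrable_sum Bochner_Integration.integrable_add partition_integrable in_ball)
  hence i1: "integrable \<mu> (\<lambda>x. b * G x)" by simp
  have i2: "norm (\<psi> x * (h x * exp (\<theta> \<bullet> T x)) * exp (\<delta> * norm (T x))) \<le> norm (b * G x)"
    if x: "x \<in> space \<mu>" for x
  proof -
    have h: "h x \<ge> 0" by (rule h_nonneg[OF x])
    have G: "G x = h x * exp (\<theta> \<bullet> T x) * (\<Sum>i\<in>UNIV. exp (e * T x $ i) + exp (- e * T x $ i))"
      unfolding G_def sum_distrib_left
      by (intro sum.cong refl)
        (simp add: inner_add_left inner_diff_left inner_axis' exp_add exp_diff exp_minus field_simps)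
    have "h x * exp (\<theta> \<bullet> T x) * exp (\<delta> * norm (T x)) \<le> G x"
      unfolding G using exp_norm_le_sum_axes[of \<delta> "T x"] \<delta> h by (intro mult_left_mono) auto
    moreover have "\<bar>\<psi> x\<bar> \<le> b" "0 \<le> h x * exp (\<theta> \<bullet> T x) * exp (\<delta> * norm (T x))" using b x h by auto
    ultimately have "\<bar>\<psi> x\<bar> * (h x * exp (\<theta> \<bullet> T x) * exp (\<delta> * norm (T x))) \<le> b * G x"
      by (intro mult_mono) auto
    hence "\<bar>\<psi> x\<bar> * (h x * exp (\<theta> \<bullet> T x) * exp (\<delta> * norm (T x))) \<le> \<bar>b * G x\<bar>" by linarith
    thus ?thesis using h by (simp only: abs_mult real_norm_def abs_exp_cancel abs_of_nonneg mult_ac)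
  qed
  have "integrable \<mu> (\<lambda>x. \<psi> x * (h x * exp (\<theta> \<bullet> T x)) * exp (\<delta> * norm (T x)))"
    by (rule Bochner_Integration.integrable_bound[OF i1 _ AE_I2[OF i2]]) measurable
  with \<delta> show "\<exists>\<delta>>0. integrable \<mu> (\<lambda>x. \<psi> x * (h x * exp (\<theta> \<bullet> T x)) * exp (\<delta> * norm (T x)))" by blast
qed fact

text \<open>Half of the slack pays for the factor \<open>T x $ i\<close>; the other half remains as
  the new slack.\<close>

lemma tame_times:
  assumes "\<psi> \<in> tame"
  shows "(\<lambda>x. \<psi> x * T x $ i) \<in> tame"
  unfolding tame_def
proof (intro CollectI conjI ballI)
  have [measurable]: "\<psi> \<in> borel_measurable \<mu>" using assms by (simp add: tame_def)
  show "(\<lambda>x. \<psi> x * T x $ i) \<in> borel_measurable \<mu>" by measurable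
  fix \<theta> assume "\<theta> \<in> \<Theta>"
  then obtain \<delta> where \<delta>: "\<delta> > 0"
    and int: "integrable \<mu> (\<lambda>x. \<psi> x * (h x * exp (\<theta> \<bullet> T x)) * exp (\<delta> * norm (T x)))"
    using assms by (auto simp: tame_def)
  have i1: "integrable \<mu> (\<lambda>x. 2 / \<delta> * (\<psi> x * (h x * exp (\<theta> \<bullet> T x)) * exp (\<delta> * norm (T x))))"
    using int by simp
  have i2: "norm (\<psi> x * T x $ i * (h x * exp (\<theta> \<bullet> T x)) * exp (\<delta> / 2 * norm (T x)))
      \<le> norm (2 / \<delta> * (\<psi> x * (h x * exp (\<theta> \<bullet> T x)) * exp (\<delta> * norm (T x))))" for x
  proof -
    have "\<bar>T x $ i\<bar> \<le> norm (T x)" by (rule component_le_norm_cart)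
    also have "\<dots> \<le> 2 / \<delta> * exp (\<delta> / 2 * norm (T x))"
      using le_exp_scaled[of "\<delta> / 2" "norm (T x)"] \<delta> by simp
    finally have "\<bar>T x $ i\<bar> * exp (\<delta> / 2 * norm (T x)) \<le> 2 / \<delta> * exp (\<delta> / 2 * norm (T x)) * exp (\<delta> / 2 * norm (T x))"
      by (intro mult_right_mono) auto
    also have "\<dots> = 2 / \<delta> * exp (\<delta> * norm (T x))" by (simp flip: exp_add)
    finally have "\<bar>\<psi> x * (h x * exp (\<theta> \<bullet> T x))\<bar> * (\<bar>T x $ i\<bar> * exp (\<delta> / 2 * norm (T x)))
        \<le> \<bar>\<psi> x * (h x * exp (\<theta> \<bullet> T x))\<bar> * (2 / \<delta> * exp (\<delta> * norm (T x)))"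
      by (rule mult_left_mono) simp
    thus ?thesis using \<delta> by (simp add: abs_mult mult_ac)
  qed
  have "integrable \<mu> (\<lambda>x. \<psi> x * T x $ i * (h x * exp (\<theta> \<bullet> T x)) * exp (\<delta> / 2 * norm (T x)))"
    by (rule Bochner_Integration.integrable_bound[OF i1 _ AE_I2[OF i2]]) measurable
  with \<delta> show "\<exists>\<delta>>0. integrable \<mu> (\<lambda>x. \<psi> x * T x $ i * (h x * exp (\<theta> \<bullet> T x)) * exp (\<delta> * norm (T x)))"
    by (intro exI[of _ "\<delta> / 2"]) simp
qed

lemma tame_integrable:
  assumes "\<psi> \<in> tame" "\<theta> \<in> \<Theta>"
  shows "integrable \<mu> (\<lambda>x. \<psi> x * (h x * exp (\<theta> \<bullet> T x)))"
proof -
  have [measurable]: "\<psi> \<in> borel_measurable \<mu>" using assms by (simp add: tame_def)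
  obtain \<delta> where \<delta>: "\<delta> > 0"
    and int: "integrable \<mu> (\<lambda>x. \<psi> x * (h x * exp (\<theta> \<bullet> T x)) * exp (\<delta> * norm (T x)))"
    using assms by (auto simp: tame_def)
  show ?thesis
  proof (rule Bochner_Integration.integrable_bound[OF int], measurable, intro AE_I2)
    fix x
    have "\<bar>\<psi> x * (h x * exp (\<theta> \<bullet> T x))\<bar> * 1 \<le> \<bar>\<psi> x * (h x * exp (\<theta> \<bullet> T x))\<bar> * exp (\<delta> * norm (T x))"
      using \<delta> by (intro mult_left_mono) auto
    thus "norm (\<psi> x * (h x * exp (\<theta> \<bullet> T x))) \<le> norm (\<psi> x * (h x * exp (\<theta> \<bullet> T x)) * exp (\<delta> * norm (T x)))"
      by (simp add: abs_mult)
  qed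
qed

text \<open>An explicit estimate instead of a limit theorem: with s the inner product of u and
  \<open>T x\<close>, the remainder \<open>exp s - 1 - s\<close> is at most
  \<open>norm u ^ 2\<close> times an expression absorbed by the slack, so the integrated remainder
  is quadratic in u.\<close>

lemma moment_has_derivative:
  assumes \<psi>: "\<psi> \<in> tame" and \<theta>: "\<theta> \<in> \<Theta>"
  shows "(moment \<psi> has_derivative (\<lambda>u. \<Sum>i\<in>UNIV. moment (\<lambda>x. \<psi> x * T x $ i) \<theta> * u $ i)) (at \<theta>)"
proof -
  have [measurable]: "\<psi> \<in> borel_measurable \<mu>" using assms by (simp add: tame_def)
  obtain \<delta> where \<delta>: "\<delta> > 0"
    and int: "integrable \<mu> (\<lambda>x. \<psi> x * (h x * exp (\<theta> \<bullet> T x)) * exp (\<delta> * norm (T x)))"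
    using assms by (auto simp: tame_def)
  obtain e where e: "e > 0" "cball \<theta> e \<subseteq> \<Theta>" using open_params \<theta> open_contains_cball by blast
  define g where "g x = \<psi> x * (h x * exp (\<theta> \<bullet> T x))" for x
  have [measurable]: "g \<in> borel_measurable \<mu>" unfolding g_def by measurable
  \<comment> \<open>Half of \<delta> pays for \<open>exp \<bar>s\<bar>\<close>, as
    \<open>norm u \<le> \<delta> / 2\<close>. The other half pays for the square of
    \<open>norm (T x)\<close>, a quarter of \<delta> for each factor at the price
    \<open>4 / \<delta>\<close>.\<close>
  define C where "C = (4 / \<delta>)\<^sup>2 * (\<integral>x. \<bar>g x * exp (\<delta> * norm (T x))\<bar> \<partial>\<mu>)"
  have int_abs: "integrable \<mu> (\<lambda>x. \<bar>g x * exp (\<delta> * norm (T x))\<bar>)"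
    using integrable_norm[OF int] by (simp add: g_def)
  show ?thesis
  proof (rule has_derivative_quadratic_remainder[where \<epsilon> = "min e (\<delta> / 2)" and C = C])
    show "bounded_linear (\<lambda>u. \<Sum>i\<in>UNIV. moment (\<lambda>x. \<psi> x * T x $ i) \<theta> * u $ i)"
      by (intro bounded_linear_sum bounded_linear_const_mult bounded_linear_vec_nth)
    show "min e (\<delta> / 2) > 0" using e \<delta> by simp
    fix u :: "real ^ 'd" assume u: "norm u \<le> min e (\<delta> / 2)"
    have \<theta>u: "\<theta> + u \<in> \<Theta>" using u by (intro subsetD[OF e(2)]) (simp add: dist_norm)
    have lin: "(\<Sum>i\<in>UNIV. moment (\<lambda>x. \<psi> x * T x $ i) \<theta> * u $ i) = (\<integral>x. g x * (u \<bullet> T x) \<partial>\<mu>)"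
    proof -
      have "(\<Sum>i\<in>UNIV. moment (\<lambda>x. \<psi> x * T x $ i) \<theta> * u $ i)
          = (\<integral>x. (\<Sum>i\<in>UNIV. \<psi> x * T x $ i * (h x * exp (\<theta> \<bullet> T x)) * u $ i) \<partial>\<mu>)"
        unfolding moment_def
        by (subst Bochner_Integration.integral_sum)
          (auto intro!: tame_integrable tame_times \<psi> \<theta>)
      also have "\<dots> = (\<integral>x. g x * (u \<bullet> T x) \<partial>\<mu>)"
        by (intro Bochner_Integration.integral_cong refl)
          (simp add: g_def inner_vec_def[of u] sum_distrib_left sum_distrib_right mult_ac)
      finally show ?thesis .
    qed
    have int_lin: "integrable \<mu> (\<lambda>x. g x * (u \<bullet> T x))"
    proof -
      have "integrable \<mu> (\<lambda>x. (\<Sum>i\<in>UNIV. \<psi> x * T x $ i * (h x * exp (\<theta> \<bullet> T x)) * u $ i))"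
        by (auto intro!: tame_integrable tame_times \<psi> \<theta>)
      thus ?thesis
        by (simp add: g_def inner_vec_def[of u] sum_distrib_left sum_distrib_right mult_ac)
    qed
    have ints: "integrable \<mu> (\<lambda>x. \<psi> x * (h x * exp ((\<theta> + u) \<bullet> T x)))" "integrable \<mu> g"
      using tame_integrable[OF \<psi>] \<theta> \<theta>u unfolding g_def by blast+
    have "moment \<psi> (\<theta> + u) - moment \<psi> \<theta> - (\<Sum>i\<in>UNIV. moment (\<lambda>x. \<psi> x * T x $ i) \<theta> * u $ i)
        = (\<integral>x. \<psi> x * (h x * exp ((\<theta> + u) \<bullet> T x)) - g x - g x * (u \<bullet> T x) \<partial>\<mu>)"
      using ints int_lin unfolding lin unfolding moment_def g_def by simp
    also have "\<dots> = (\<integral>x. g x * (exp (u \<bullet> T x) - 1 - u \<bullet> T x) \<partial>\<mu>)"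
      by (intro Bochner_Integration.integral_cong refl)
        (simp add: g_def inner_add_left exp_add algebra_simps)
    also have "norm \<dots> \<le> (\<integral>x. (4 / \<delta>)\<^sup>2 * (norm u)\<^sup>2 * \<bar>g x * exp (\<delta> * norm (T x))\<bar> \<partial>\<mu>)"
    proof (rule order_trans[OF Bochner_Integration.integral_norm_bound Bochner_Integration.integral_mono])
      show "integrable \<mu> (\<lambda>x. (4 / \<delta>)\<^sup>2 * (norm u)\<^sup>2 * \<bar>g x * exp (\<delta> * norm (T x))\<bar>)"
        using int_abs by simp
      have "integrable \<mu> (\<lambda>x. \<psi> x * (h x * exp ((\<theta> + u) \<bullet> T x)) - g x - g x * (u \<bullet> T x))"
        using ints int_lin by simp
      hence "integrable \<mu> (\<lambda>x. g x * (exp (u \<bullet> T x) - 1 - u \<bullet> T x))"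
        by (rule Bochner_Integration.integrable_cong[THEN iffD1, rotated 2])
          (simp_all add: g_def inner_add_left exp_add algebra_simps)
      thus "integrable \<mu> (\<lambda>x. norm (g x * (exp (u \<bullet> T x) - 1 - u \<bullet> T x)))"
        by (rule integrable_norm)
      fix x
      define t where "t = norm (T x)"
      have t: "t \<ge> 0" by (simp add: t_def)
      have s: "\<bar>u \<bullet> T x\<bar> \<le> norm u * t" unfolding t_def by (rule Cauchy_Schwarz_ineq2)
      have "\<bar>exp (u \<bullet> T x) - 1 - u \<bullet> T x\<bar> \<le> (u \<bullet> T x)\<^sup>2 * exp \<bar>u \<bullet> T x\<bar>" by (rule exp_remainder_bound)
      also have "\<dots> \<le> (norm u * t)\<^sup>2 * exp (\<delta> / 2 * t)"
      proof (rule mult_mono)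
        show "(u \<bullet> T x)\<^sup>2 \<le> (norm u * t)\<^sup>2" using s by (metis abs_le_square_iff abs_of_nonneg abs_ge_zero order_trans)
        have "norm u * t \<le> \<delta> / 2 * t" using u t by (intro mult_right_mono) auto
        thus "exp \<bar>u \<bullet> T x\<bar> \<le> exp (\<delta> / 2 * t)" using s by simp
      qed auto
      also have "\<dots> \<le> (norm u)\<^sup>2 * ((4 / \<delta>)\<^sup>2 * exp (\<delta> * t))"
      proof -
        have "t \<le> 4 / \<delta> * exp (\<delta> / 4 * t)" using le_exp_scaled[of "\<delta> / 4" t] \<delta> by simp
        hence "t\<^sup>2 \<le> (4 / \<delta> * exp (\<delta> / 4 * t))\<^sup>2" using t by (rule power_mono)
        also have "\<dots> = (4 / \<delta>)\<^sup>2 * exp (\<delta> / 2 * t)"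
          by (simp add: power_mult_distrib power2_eq_square flip: exp_add)
        finally have "t\<^sup>2 * exp (\<delta> / 2 * t) \<le> (4 / \<delta>)\<^sup>2 * exp (\<delta> / 2 * t) * exp (\<delta> / 2 * t)"
          by (intro mult_right_mono) auto
        also have "\<dots> = (4 / \<delta>)\<^sup>2 * exp (\<delta> * t)" by (simp flip: exp_add)
        finally have "(norm u)\<^sup>2 * (t\<^sup>2 * exp (\<delta> / 2 * t)) \<le> (norm u)\<^sup>2 * ((4 / \<delta>)\<^sup>2 * exp (\<delta> * t))"
          by (rule mult_left_mono) simp
        thus ?thesis by (simp only: power_mult_distrib mult.assoc)
      qed
      finally have "\<bar>g x\<bar> * \<bar>exp (u \<bullet> T x) - 1 - u \<bullet> T x\<bar> \<le> \<bar>g x\<bar> * ((norm u)\<^sup>2 * ((4 / \<delta>)\<^sup>2 * exp (\<delta> * t)))"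
        by (rule mult_left_mono) simp
      thus "norm (g x * (exp (u \<bullet> T x) - 1 - u \<bullet> T x)) \<le> (4 / \<delta>)\<^sup>2 * (norm u)\<^sup>2 * \<bar>g x * exp (\<delta> * norm (T x))\<bar>"
        by (simp add: abs_mult t_def mult_ac)
    qed
    also have "\<dots> = C * (norm u)\<^sup>2" by (simp add: C_def)
    finally show "norm (moment \<psi> (\<theta> + u) - moment \<psi> \<theta> - (\<Sum>i\<in>UNIV. moment (\<lambda>x. \<psi> x * T x $ i) \<theta> * u $ i))
        \<le> C * (norm u)\<^sup>2" .
  qed
qed

end

section \<open>Taylor expansions with uniform remainders\<close>

lemma partials_lipschitz:
  fixes f :: "real ^ 'd \<Rightarrow> real"
  assumes "convex S"
    and deriv: "\<And>z. z \<in> S \<Longrightarrow> (f has_derivative (\<lambda>u. \<Sum>i\<in>UNIV. f' i z * u $ i)) (at z)"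
    and bound: "\<And>z i. z \<in> S \<Longrightarrow> \<bar>f' i z\<bar> \<le> B i"
    and "x \<in> S" "y \<in> S"
  shows "\<bar>f y - f x\<bar> \<le> (\<Sum>i\<in>UNIV. B i) * norm (y - x)"
proof -
  have "norm (f y - f x) \<le> (\<Sum>i\<in>UNIV. B i) * norm (y - x)"
  proof (rule differentiable_bound[OF \<open>convex S\<close> _ _ \<open>y \<in> S\<close> \<open>x \<in> S\<close>])
    show "(f has_derivative (\<lambda>u. \<Sum>i\<in>UNIV. f' i z * u $ i)) (at z within S)" if "z \<in> S" for z
      using deriv[OF that] by (rule has_derivative_at_withinI)
    show "onorm (\<lambda>u. \<Sum>i\<in>UNIV. f' i z * u $ i) \<le> (\<Sum>i\<in>UNIV. B i)" if "z \<in> S" for z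
    proof (rule onorm_le)
      fix u :: "real ^ 'd"
      have "norm (\<Sum>i\<in>UNIV. f' i z * u $ i) \<le> (\<Sum>i\<in>UNIV. B i * norm u)"
      proof (rule sum_norm_le)
        fix i
        show "norm (f' i z * u $ i) \<le> B i * norm u"
          unfolding norm_mult using bound[OF that, of i]
          by (intro mult_mono) (auto simp: component_le_norm_cart intro: order_trans[OF abs_ge_zero])
      qed
      thus "norm (\<Sum>i\<in>UNIV. f' i z * u $ i) \<le> (\<Sum>i\<in>UNIV. B i) * norm u"
        by (simp add: sum_distrib_right)
    qed
  qed
  thus ?thesis by simp
qed

text \<open>Subtracting the linear map with coefficients \<open>f' i x\<close> leaves partials
  \<open>f' i z - f' i x\<close>, which on the segment are at most
  \<open>L i * norm (y - x)\<close>. The mean value inequality then contributes the second factor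
  \<open>norm (y - x)\<close>.\<close>

lemma partials_linearization:
  fixes f :: "real ^ 'd \<Rightarrow> real"
  assumes "convex S"
    and deriv: "\<And>z. z \<in> S \<Longrightarrow> (f has_derivative (\<lambda>u. \<Sum>i\<in>UNIV. f' i z * u $ i)) (at z)"
    and lip: "\<And>x y i. x \<in> S \<Longrightarrow> y \<in> S \<Longrightarrow> \<bar>f' i y - f' i x\<bar> \<le> L i * norm (y - x)"
    and L: "\<And>i. 0 \<le> L i"
    and x: "x \<in> S" and y: "y \<in> S"
  shows "\<bar>f y - f x - (\<Sum>i\<in>UNIV. f' i x * (y - x) $ i)\<bar> \<le> (\<Sum>i\<in>UNIV. L i) * (norm (y - x))\<^sup>2"
proof -
  define q where "q z = f z - (\<Sum>i\<in>UNIV. f' i x * z $ i)" for z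
  have seg: "closed_segment x y \<subseteq> S" using x y \<open>convex S\<close> by (rule closed_segment_subset)
  have "\<bar>q y - q x\<bar> \<le> (\<Sum>i\<in>UNIV. L i * norm (y - x)) * norm (y - x)"
  proof (rule partials_lipschitz[where f' = "\<lambda>i z. f' i z - f' i x" and S = "closed_segment x y"])
    fix z assume z: "z \<in> closed_segment x y"
    hence zS: "z \<in> S" using seg by blast
    have "bounded_linear (\<lambda>u. \<Sum>i\<in>UNIV. f' i x * u $ i)"
      by (intro bounded_linear_sum bounded_linear_const_mult bounded_linear_vec_nth)
    from has_derivative_diff[OF deriv[OF zS] bounded_linear_imp_has_derivative[OF this]]
    show "(q has_derivative (\<lambda>u. \<Sum>i\<in>UNIV. (f' i z - f' i x) * u $ i)) (at z)"
      unfolding q_def by (simp add: left_diff_distrib sum_subtractf)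
    fix i
    have "\<bar>f' i z - f' i x\<bar> \<le> L i * norm (z - x)" by (rule lip[OF x zS])
    also have "\<dots> \<le> L i * norm (y - x)"
      using segment_bound(1)[OF z] L by (intro mult_left_mono) (auto simp: norm_minus_commute)
    finally show "\<bar>f' i z - f' i x\<bar> \<le> L i * norm (y - x)" .
  qed auto
  also have "q y - q x = f y - f x - (\<Sum>i\<in>UNIV. f' i x * (y - x) $ i)"
    by (simp add: q_def algebra_simps sum_subtractf)
  finally show ?thesis by (simp add: power2_eq_square sum_distrib_right mult.assoc)
qed

text \<open>The mean value theorem is applied on [0, 1] to f along the segment minus its quadratic
  Taylor polynomial. The derivative of this difference at t is the linearization error of the
  partials at displacement \<open>t *\<^sub>R v\<close>, paired with v; that pairing raises the
  order from two to three.\<close>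

lemma partials_taylor2:
  fixes f :: "real ^ 'd \<Rightarrow> real"
  assumes "convex S"
    and deriv: "\<And>z. z \<in> S \<Longrightarrow> (f has_derivative (\<lambda>u. \<Sum>i\<in>UNIV. f' i z * u $ i)) (at z)"
    and lin: "\<And>x y i. x \<in> S \<Longrightarrow> y \<in> S \<Longrightarrow>
      \<bar>f' i y - f' i x - (\<Sum>j\<in>UNIV. f'' i j x * (y - x) $ j)\<bar> \<le> C i * (norm (y - x))\<^sup>2"
    and C: "\<And>i. 0 \<le> C i"
    and x: "x \<in> S" and xv: "x + v \<in> S"
  shows "\<bar>f (x + v) - f x - (\<Sum>i\<in>UNIV. f' i x * v $ i)
      - 1 / 2 * (\<Sum>i\<in>UNIV. (\<Sum>j\<in>UNIV. f'' i j x * v $ j) * v $ i)\<bar> \<le> (\<Sum>i\<in>UNIV. C i) * norm v ^ 3"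
proof -
  define G where "G = (\<Sum>i\<in>UNIV. f' i x * v $ i)"
  define H where "H i = (\<Sum>j\<in>UNIV. f'' i j x * v $ j)" for i
  define q where "q t = f (x + t *\<^sub>R v) - t * G - t\<^sup>2 / 2 * (\<Sum>i\<in>UNIV. H i * v $ i)" for t
  define q' where "q' t = (\<Sum>i\<in>UNIV. f' i (x + t *\<^sub>R v) * v $ i) - G - t * (\<Sum>i\<in>UNIV. H i * v $ i)" for t
  have in_S: "x + t *\<^sub>R v \<in> S" if "0 \<le> t" "t \<le> 1" for t
  proof -
    have "x + t *\<^sub>R v = (1 - t) *\<^sub>R x + t *\<^sub>R (x + v)" by (simp add: algebra_simps)
    also have "\<dots> \<in> S" using x xv that \<open>convex S\<close> by (intro convexD) auto
    finally show ?thesis .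
  qed
  have "DERIV q t :> q' t" if t: "0 \<le> t" "t \<le> 1" for t
  proof -
    have "((\<lambda>t. x + t *\<^sub>R v) has_derivative (\<lambda>s. s *\<^sub>R v)) (at t)"
      by (auto intro!: derivative_eq_intros)
    from has_derivative_compose[OF this deriv[OF in_S[OF t]]]
    have "DERIV (\<lambda>t. f (x + t *\<^sub>R v)) t :> (\<Sum>i\<in>UNIV. f' i (x + t *\<^sub>R v) * v $ i)"
      unfolding has_field_derivative_def
      by (rule has_derivative_eq_rhs) (auto simp: sum_distrib_left mult_ac)
    note [derivative_intros] = this
    show ?thesis unfolding q_def[abs_def] q'_def
      by (rule derivative_eq_intros refl | simp)+
  qed
  from MVT2[of 0 1 q q', OF _ this] obtain t where t: "0 < t" "t < 1" "q 1 - q 0 = q' t" by auto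
  have "(\<Sum>j\<in>UNIV. f'' i j x * (x + t *\<^sub>R v - x) $ j) = t * H i" for i
    by (simp add: H_def sum_distrib_left mult_ac)
  hence "q' t = (\<Sum>i\<in>UNIV. (f' i (x + t *\<^sub>R v) - f' i x - (\<Sum>j\<in>UNIV. f'' i j x * (x + t *\<^sub>R v - x) $ j)) * v $ i)"
    by (simp add: q'_def G_def sum_subtractf left_diff_distrib sum_distrib_left mult.assoc)
  also have "norm \<dots> \<le> (\<Sum>i\<in>UNIV. C i * norm v ^ 3)"
  proof (rule sum_norm_le)
    fix i
    have "\<bar>f' i (x + t *\<^sub>R v) - f' i x - (\<Sum>j\<in>UNIV. f'' i j x * (x + t *\<^sub>R v - x) $ j)\<bar>
        \<le> C i * (norm (x + t *\<^sub>R v - x))\<^sup>2"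
      using t by (intro lin x in_S) auto
    also have "\<dots> \<le> C i * (norm v)\<^sup>2"
      using t C by (intro mult_left_mono power_mono) (auto intro: mult_left_le_one_le)
    finally have "\<bar>f' i (x + t *\<^sub>R v) - f' i x - (\<Sum>j\<in>UNIV. f'' i j x * (x + t *\<^sub>R v - x) $ j)\<bar> * \<bar>v $ i\<bar>
        \<le> C i * (norm v)\<^sup>2 * norm v"
      using C by (intro mult_mono) (auto simp: component_le_norm_cart)
    thus "norm ((f' i (x + t *\<^sub>R v) - f' i x - (\<Sum>j\<in>UNIV. f'' i j x * (x + t *\<^sub>R v - x) $ j)) * v $ i)
        \<le> C i * norm v ^ 3"
      by (simp add: abs_mult power2_eq_square power3_eq_cube mult.assoc)
  qed
  finally show ?thesis
    using t(3) by (simp add: q_def G_def H_def sum_distrib_right algebra_simps)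
qed

section \<open>Smooth functions on the parameter set\<close>

context exponential_family
begin

text \<open>
  A class of functions on \<open>\<Theta>\<close> that is closed under partial derivatives, hence consists of smooth
  functions; it contains the derivatives of the log-partition function and of the means.
\<close>

inductive_set smooth_algebra :: "(real ^ 'd \<Rightarrow> real) set" where
  moment: "\<psi> \<in> tame \<Longrightarrow> moment \<psi> \<in> smooth_algebra"
| add: "f \<in> smooth_algebra \<Longrightarrow> g \<in> smooth_algebra \<Longrightarrow> (\<lambda>\<theta>. f \<theta> + g \<theta>) \<in> smooth_algebra"
| minus: "f \<in> smooth_algebra \<Longrightarrow> (\<lambda>\<theta>. - f \<theta>) \<in> smooth_algebra"
| mult: "f \<in> smooth_algebra \<Longrightarrow> g \<in> smooth_algebra \<Longrightarrow> (\<lambda>\<theta>. f \<theta> * g \<theta>) \<in> smooth_algebra"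
| inverse: "f \<in> smooth_algebra \<Longrightarrow> (\<And>\<theta>. \<theta> \<in> \<Theta> \<Longrightarrow> f \<theta> \<noteq> 0) \<Longrightarrow> (\<lambda>\<theta>. inverse (f \<theta>)) \<in> smooth_algebra"

text \<open>Partials are kept as scalar functions rather than as one vector field, so that each can
  itself be a member of \<open>smooth_algebra\<close> and be differentiated again.\<close>

definition has_partials :: "(real ^ 'd \<Rightarrow> real) \<Rightarrow> ('d \<Rightarrow> real ^ 'd \<Rightarrow> real) \<Rightarrow> bool"
  where "has_partials f f' \<longleftrightarrow>
    (\<forall>\<theta>\<in>\<Theta>. (f has_derivative (\<lambda>u. \<Sum>i\<in>UNIV. f' i \<theta> * u $ i)) (at \<theta>))"

lemma moment_partials:
  "\<psi> \<in> tame \<Longrightarrow> has_partials (moment \<psi>) (\<lambda>i. moment (\<lambda>x. \<psi> x * T x $ i))"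
  by (simp add: has_partials_def moment_has_derivative)

lemma minus_partials: "has_partials f f' \<Longrightarrow> has_partials (\<lambda>\<theta>. - f \<theta>) (\<lambda>i \<theta>. - f' i \<theta>)"
  unfolding has_partials_def
  by (auto intro!: derivative_eq_intros simp: sum_negf)

lemma add_partials:
  "has_partials f f' \<Longrightarrow> has_partials g g' \<Longrightarrow> has_partials (\<lambda>\<theta>. f \<theta> + g \<theta>) (\<lambda>i \<theta>. f' i \<theta> + g' i \<theta>)"
  unfolding has_partials_def
  by (auto intro!: derivative_eq_intros simp: sum.distrib distrib_right)

lemma mult_partials:
  "has_partials f f' \<Longrightarrow> has_partials g g' \<Longrightarrow>
    has_partials (\<lambda>\<theta>. f \<theta> * g \<theta>) (\<lambda>i \<theta>. f \<theta> * g' i \<theta> + f' i \<theta> * g \<theta>)"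
  unfolding has_partials_def
  by (auto intro!: derivative_eq_intros
    simp: sum.distrib distrib_left sum_distrib_left sum_distrib_right mult_ac)

lemma inverse_partials:
  assumes "has_partials f f'" "\<And>\<theta>. \<theta> \<in> \<Theta> \<Longrightarrow> f \<theta> \<noteq> 0"
  shows "has_partials (\<lambda>\<theta>. inverse (f \<theta>)) (\<lambda>i \<theta>. - (f' i \<theta> * (inverse (f \<theta>) * inverse (f \<theta>))))"
  unfolding has_partials_def
proof
  fix \<theta> assume "\<theta> \<in> \<Theta>"
  thus "((\<lambda>\<theta>. inverse (f \<theta>)) has_derivative
      (\<lambda>u. \<Sum>i\<in>UNIV. - (f' i \<theta> * (inverse (f \<theta>) * inverse (f \<theta>))) * u $ i)) (at \<theta>)"
    using assms unfolding has_partials_def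
    by (auto intro!: derivative_eq_intros simp: sum_distrib_left sum_distrib_right sum_negf mult_ac)
qed

text \<open>The sum, product and reciprocal rules express partials through the functions and their
  partials by the operations that generate the class. Only the base case uses the family itself,
  through \<open>tame_times\<close>.\<close>

lemma smooth_algebra_partials:
  "f \<in> smooth_algebra \<Longrightarrow> \<exists>f'. has_partials f f' \<and> (\<forall>i. f' i \<in> smooth_algebra)"
proof (induction rule: smooth_algebra.induct)
  case (moment \<psi>)
  thus ?case using moment_partials tame_times smooth_algebra.moment by blast
next
  case (add f g)
  then obtain f' g' where "has_partials f f'" "has_partials g g'"
    "\<And>i. f' i \<in> smooth_algebra" "\<And>i. g' i \<in> smooth_algebra" by blast
  with add show ?case
    by (intro exI[of _ "\<lambda>i \<theta>. f' i \<theta> + g' i \<theta>"] conjI add_partials allI smooth_algebra.intros)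
next
  case (minus f)
  then obtain f' where "has_partials f f'" "\<And>i. f' i \<in> smooth_algebra" by blast
  thus ?case by (intro exI[of _ "\<lambda>i \<theta>. - f' i \<theta>"] conjI minus_partials allI smooth_algebra.intros)
next
  case (mult f g)
  then obtain f' g' where "has_partials f f'" "has_partials g g'"
    "\<And>i. f' i \<in> smooth_algebra" "\<And>i. g' i \<in> smooth_algebra" by blast
  with mult show ?case
    by (intro exI[of _ "\<lambda>i \<theta>. f \<theta> * g' i \<theta> + f' i \<theta> * g \<theta>"] conjI mult_partials allI smooth_algebra.intros)
next
  case (inverse f)
  then obtain f' where "has_partials f f'" "\<And>i. f' i \<in> smooth_algebra" by blast
  with inverse show ?case
    by (intro exI[of _ "\<lambda>i \<theta>. - (f' i \<theta> * (inverse (f \<theta>) * inverse (f \<theta>)))"] conjI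
      inverse_partials allI smooth_algebra.intros)
qed

lemma smooth_algebra_bounded:
  assumes f: "f \<in> smooth_algebra" and S: "compact S" "S \<subseteq> \<Theta>"
  obtains B where "B \<ge> 0" "\<And>z. z \<in> S \<Longrightarrow> \<bar>f z\<bar> \<le> B"
proof -
  obtain f' where f': "has_partials f f'" using smooth_algebra_partials[OF f] by blast
  have "continuous_on S f"
    using f' S(2) unfolding has_partials_def
    by (intro has_derivative_continuous_on) (blast intro: has_derivative_at_withinI)
  hence "bounded (f ` S)" using S(1) by (intro compact_imp_bounded compact_continuous_image)
  then obtain B where "B > 0" "\<And>z. z \<in> S \<Longrightarrow> \<bar>f z\<bar> \<le> B"
    unfolding bounded_pos by auto
  thus ?thesis using that[of B] by simp
qed

lemma smooth_algebra_lipschitz: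
  assumes f: "f \<in> smooth_algebra" and S: "compact S" "convex S" "S \<subseteq> \<Theta>"
  obtains L where "L \<ge> 0" "\<And>x y. x \<in> S \<Longrightarrow> y \<in> S \<Longrightarrow> \<bar>f y - f x\<bar> \<le> L * norm (y - x)"
proof -
  obtain f' where f': "has_partials f f'" "\<And>i. f' i \<in> smooth_algebra"
    using smooth_algebra_partials[OF f] by blast
  have "\<exists>B. B \<ge> 0 \<and> (\<forall>z\<in>S. \<bar>f' i z\<bar> \<le> B)" for i
    using smooth_algebra_bounded[OF f'(2) S(1,3)] by metis
  then obtain B where B: "\<And>i. B i \<ge> 0" "\<And>i z. z \<in> S \<Longrightarrow> \<bar>f' i z\<bar> \<le> B i" by metis
  have "\<bar>f y - f x\<bar> \<le> (\<Sum>i\<in>UNIV. B i) * norm (y - x)" if "x \<in> S" "y \<in> S" for x y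
    using f'(1) S(3) that unfolding has_partials_def
    by (intro partials_lipschitz[OF S(2), of f f'] B) auto
  thus ?thesis using that[of "\<Sum>i\<in>UNIV. B i"] B by (simp add: sum_nonneg)
qed

lemma smooth_algebra_linearization:
  assumes f: "has_partials f f'" "\<And>i. f' i \<in> smooth_algebra"
    and S: "compact S" "convex S" "S \<subseteq> \<Theta>"
  obtains C where "C \<ge> 0" "\<And>x y. x \<in> S \<Longrightarrow> y \<in> S \<Longrightarrow>
    \<bar>f y - f x - (\<Sum>i\<in>UNIV. f' i x * (y - x) $ i)\<bar> \<le> C * (norm (y - x))\<^sup>2"
proof -
  have "\<exists>L. L \<ge> 0 \<and> (\<forall>x\<in>S. \<forall>y\<in>S. \<bar>f' i y - f' i x\<bar> \<le> L * norm (y - x))" for i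
    using smooth_algebra_lipschitz[OF f(2) S] by metis
  then obtain L where L: "\<And>i. L i \<ge> 0"
    "\<And>i x y. x \<in> S \<Longrightarrow> y \<in> S \<Longrightarrow> \<bar>f' i y - f' i x\<bar> \<le> L i * norm (y - x)" by metis
  have "\<bar>f y - f x - (\<Sum>i\<in>UNIV. f' i x * (y - x) $ i)\<bar> \<le> (\<Sum>i\<in>UNIV. L i) * (norm (y - x))\<^sup>2"
    if "x \<in> S" "y \<in> S" for x y
    using f(1) S(3) that unfolding has_partials_def
    by (intro partials_linearization[OF S(2), of f f'] L) auto
  thus ?thesis using that[of "\<Sum>i\<in>UNIV. L i"] L by (simp add: sum_nonneg)
qed

lemma smooth_algebra_taylor2:
  assumes f: "has_partials f f'" "\<And>i. has_partials (f' i) (f'' i)" "\<And>i j. f'' i j \<in> smooth_algebra"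
    and S: "compact S" "convex S" "S \<subseteq> \<Theta>"
  obtains C where "C \<ge> 0" "\<And>x v. x \<in> S \<Longrightarrow> x + v \<in> S \<Longrightarrow>
    \<bar>f (x + v) - f x - (\<Sum>i\<in>UNIV. f' i x * v $ i)
      - 1 / 2 * (\<Sum>i\<in>UNIV. (\<Sum>j\<in>UNIV. f'' i j x * v $ j) * v $ i)\<bar> \<le> C * norm v ^ 3"
proof -
  have "\<exists>C. C \<ge> 0 \<and> (\<forall>x\<in>S. \<forall>y\<in>S.
      \<bar>f' i y - f' i x - (\<Sum>j\<in>UNIV. f'' i j x * (y - x) $ j)\<bar> \<le> C * (norm (y - x))\<^sup>2)" for i
    using smooth_algebra_linearization[OF f(2) f(3) S] by metis
  then obtain C where C: "\<And>i. C i \<ge> 0"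
    "\<And>i x y. x \<in> S \<Longrightarrow> y \<in> S \<Longrightarrow>
      \<bar>f' i y - f' i x - (\<Sum>j\<in>UNIV. f'' i j x * (y - x) $ j)\<bar> \<le> C i * (norm (y - x))\<^sup>2" by metis
  have "\<bar>f (x + v) - f x - (\<Sum>i\<in>UNIV. f' i x * v $ i)
      - 1 / 2 * (\<Sum>i\<in>UNIV. (\<Sum>j\<in>UNIV. f'' i j x * v $ j) * v $ i)\<bar> \<le> (\<Sum>i\<in>UNIV. C i) * norm v ^ 3"
    if "x \<in> S" "x + v \<in> S" for x v
    using f(1) S(3) that unfolding has_partials_def
    by (intro partials_taylor2[OF S(2), of f f' f''] C) auto
  thus ?thesis using that[of "\<Sum>i\<in>UNIV. C i"] C by (simp add: sum_nonneg)
qed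

end

section \<open>Suprema with a large quadratic penalty\<close>

lemma matrix_inv_positive_definite:
  fixes H :: "real ^ 'd ^ 'd"
  assumes "positive_definite H"
  shows "H *v (matrix_inv H *v g) = g"
proof -
  have "\<forall>x. H *v x = 0 \<longrightarrow> x = 0"
    using assms unfolding positive_definite_def by (metis inner_zero_right less_irrefl)
  hence "invertible H" by (simp add: invertible_left_inverse matrix_left_invertible_ker)
  hence "H ** matrix_inv H = mat 1"
    unfolding invertible_def matrix_inv_def by (rule someI2_ex) blast
  thus ?thesis by (simp add: matrix_vector_mul_assoc)
qed

text \<open>Expand the nonnegative form at \<open>a *\<^sub>R u - w\<close> and divide by 2a.
  Equality holds for \<open>u = w / a\<close>, the point that later serves as witness with
  \<open>a = n / k\<close>.\<close>

lemma quadratic_form_le_at_maximum: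
  fixes H :: "real ^ 'd ^ 'd"
  assumes sym: "transpose H = H" and pos: "\<And>v. 0 \<le> v \<bullet> (H *v v)" and w: "H *v w = g" and "0 < a"
  shows "g \<bullet> u - a / 2 * (u \<bullet> (H *v u)) \<le> 1 / (2 * a) * (g \<bullet> w)"
proof -
  have sw: "v \<bullet> (H *v z) = z \<bullet> (H *v v)" for v z
    using dot_lmul_matrix[of v H z] sym by (metis inner_commute vector_transpose_matrix)
  have "0 \<le> (a *\<^sub>R u - w) \<bullet> (H *v (a *\<^sub>R u - w))" by (rule pos)
  also have "\<dots> = a\<^sup>2 * (u \<bullet> (H *v u)) - 2 * a * (g \<bullet> u) + g \<bullet> w"
    using sw[of w u]
    by (simp add: matrix_vector_mult_diff_distrib matrix_vector_mult_scaleR inner_diff_left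
      inner_diff_right w power2_eq_square inner_commute algebra_simps)
  finally show ?thesis using \<open>0 < a\<close> by (simp add: field_simps power2_eq_square)
qed

text \<open>Here x stands for the estimator, D for the Bregman divergence from it and n for the
  sample size. On the ball of radius r the map m has average slope at most \<open>K + C * r\<close>
  from x, and R solves \<open>n / k * c * (R / n) = K + C * r\<close>: beyond distance
  \<open>R / n\<close> the penalty outweighs any gain. The largeness conditions on n put this
  smaller ball inside the ball of radius r and make the far penalty exceed the oscillation
  \<open>2 * b\<close> of m.\<close>

lemma penalized_sup_expansion:
  fixes \<Theta> :: "(real ^ 'd) set" and m D :: "real ^ 'd \<Rightarrow> real" and H :: "real ^ 'd ^ 'd"
    and g x :: "real ^ 'd" and n k c r b C K :: real
  defines "R \<equiv> k * (K + C * r) / c"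
  assumes pos: "0 < k" "0 < c" "0 < r" "0 \<le> C" "0 \<le> K" "0 < n"
    and ball: "\<And>u. norm u \<le> r \<Longrightarrow> x + u \<in> \<Theta>"
    and m_bound: "\<And>y. y \<in> \<Theta> \<Longrightarrow> \<bar>m y\<bar> \<le> b"
    and m_expansion: "\<And>u. norm u \<le> r \<Longrightarrow> \<bar>m (x + u) - m x - g \<bullet> u\<bar> \<le> C * (norm u)\<^sup>2"
    and g_bound: "norm g \<le> K"
    and D_expansion: "\<And>u. norm u \<le> r \<Longrightarrow> \<bar>D (x + u) - 1 / 2 * (u \<bullet> (H *v u))\<bar> \<le> C * norm u ^ 3"
    and D_near: "\<And>u. norm u \<le> r \<Longrightarrow> c * (norm u)\<^sup>2 \<le> D (x + u)"
    and D_far: "\<And>y. y \<in> \<Theta> \<Longrightarrow> r < norm (y - x) \<Longrightarrow> c * r\<^sup>2 \<le> D y"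
    and H_sym: "transpose H = H"
    and H_coercive: "\<And>u. 2 * c * (norm u)\<^sup>2 \<le> u \<bullet> (H *v u)"
    and n_large: "R \<le> n * r" "2 * b * k \<le> n * (c * r\<^sup>2)"
  shows "\<bar>(SUP y\<in>\<Theta>. m y - n / k * D y) - (m x + k / (2 * n) * (g \<bullet> (matrix_inv H *v g)))\<bar>
    \<le> (C * R\<^sup>2 + C * R ^ 3 / k) / n\<^sup>2"
proof -
  define w where "w = matrix_inv H *v g"
  define E where "E = (C * R\<^sup>2 + C * R ^ 3 / k) / n\<^sup>2"
  define V where "V = k / (2 * n) * (g \<bullet> w)"
  have "positive_definite H"
    unfolding positive_definite_def
  proof (intro allI impI)
    fix v :: "real ^ 'd" assume "v \<noteq> 0"
    hence "0 < 2 * c * (norm v)\<^sup>2" using pos by simp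
    thus "0 < v \<bullet> (H *v v)" using H_coercive[of v] by linarith
  qed
  hence w: "H *v w = g" unfolding w_def by (rule matrix_inv_positive_definite)
  have R: "R \<ge> 0" unfolding R_def using pos by (simp add: mult_nonneg_nonneg)
  have E: "E \<ge> 0" unfolding E_def using R pos by simp
  have Hnn: "0 \<le> v \<bullet> (H *v v)" for v
    using H_coercive[of v] pos by (auto intro: order_trans[rotated])
  have V: "V \<ge> 0" using Hnn[of w] pos by (simp add: V_def w inner_commute)
  have square: "g \<bullet> u - n / k / 2 * (u \<bullet> (H *v u)) \<le> V" for u
    using quadratic_form_le_at_maximum[OF H_sym Hnn w, of "n / k" u] pos by (simp add: V_def)
  have small_error: "C * (norm u)\<^sup>2 + n / k * (C * norm u ^ 3) \<le> E" if u: "norm u \<le> R / n" for u :: "real ^ 'd"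
  proof -
    have "C * (norm u)\<^sup>2 + n / k * (C * norm u ^ 3) \<le> C * (R / n)\<^sup>2 + n / k * (C * (R / n) ^ 3)"
      using u pos by (intro add_mono mult_left_mono power_mono) auto
    also have "\<dots> = E" unfolding E_def using pos
      by (simp add: field_simps power2_eq_square power3_eq_cube)
    finally show ?thesis .
  qed
  have Rn: "R / n \<le> r" using n_large(1) pos by (simp add: field_simps)
  have upper: "m y - n / k * D y \<le> m x + V + E" if y: "y \<in> \<Theta>" for y
  proof (cases "norm (y - x) \<le> r")
    case True
    define u where "u = y - x"
    have u: "norm u \<le> r" "y = x + u" using True by (simp_all add: u_def)
    show ?thesis
    proof (cases "norm u \<le> R / n")
      case True
      have "n / k * D y \<ge> n / k * (1 / 2 * (u \<bullet> (H *v u)) - C * norm u ^ 3)"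
        using D_expansion[OF u(1)] pos u(2) by (intro mult_left_mono) auto
      hence "- (n / k * D y) \<le> - (n / k / 2 * (u \<bullet> (H *v u))) + n / k * (C * norm u ^ 3)"
        by (simp add: algebra_simps)
      moreover have "m y \<le> m x + g \<bullet> u + C * (norm u)\<^sup>2" using m_expansion[OF u(1)] u(2) by auto
      ultimately show ?thesis using square[of u] small_error[OF True] by linarith
    next
      case False
      \<comment> \<open>Comparison of slopes: m gains at most \<open>K + C * r\<close> per unit of
        distance, and \<open>norm u > R / n\<close> makes the average slope
        \<open>n / k * c * norm u\<close> of the penalty at least as large.\<close>
      have "m y - m x \<le> norm u * (K + C * r)"
      proof -
        have "g \<bullet> u \<le> norm g * norm u" by (rule norm_cauchy_schwarz)
        also have "\<dots> \<le> K * norm u" using g_bound by (intro mult_right_mono) auto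
        finally have "g \<bullet> u \<le> K * norm u" .
        moreover have "C * (norm u)\<^sup>2 \<le> C * r * norm u"
          using u pos by (simp add: power2_eq_square mult.assoc mult_left_mono mult_right_mono)
        ultimately show ?thesis using m_expansion[OF u(1)] u(2) by (auto simp: algebra_simps)
      qed
      also have "\<dots> \<le> norm u * (n / k * c * norm u)"
      proof (rule mult_left_mono)
        have "R \<le> n * norm u" using False pos by (simp add: field_simps)
        thus "K + C * r \<le> n / k * c * norm u" using pos by (simp add: R_def field_simps)
      qed simp
      also have "\<dots> = n / k * (c * (norm u)\<^sup>2)" by (simp add: power2_eq_square)
      also have "\<dots> \<le> n / k * D y" using D_near[OF u(1)] u(2) pos by (intro mult_left_mono) auto
      finally show ?thesis using V E by linarith
    qed
  next
    case False
    \<comment> \<open>Outside the ball no expansion is available; boundedness of m suffices.\<close>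
    have "2 * b \<le> n / k * (c * r\<^sup>2)" using n_large(2) pos by (simp add: field_simps)
    also have "\<dots> \<le> n / k * D y" using D_far[OF y] False pos by (intro mult_left_mono) auto
    finally have "2 * b \<le> n / k * D y" .
    moreover have "x \<in> \<Theta>" using ball[of 0] pos by simp
    ultimately show ?thesis using m_bound[OF y] m_bound[of x] V E by linarith
  qed
  \<comment> \<open>The exact maximizer of the concave quadratic, so that its value V is
    attained.\<close>
  define u where "u = (k / n) *\<^sub>R w"
  \<comment> \<open>Coercivity bounds w by the gradient; this places the witness within distance
    \<open>R / n\<close>, where \<open>small_error\<close> applies.\<close>
  have "norm w * (2 * c * norm w) \<le> norm w * K"
  proof -
    have "norm w * (2 * c * norm w) = 2 * c * (norm w)\<^sup>2" by (simp add: power2_eq_square)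
    also have "\<dots> \<le> w \<bullet> g" using H_coercive[of w] w by simp
    also have "\<dots> \<le> norm w * norm g" by (rule norm_cauchy_schwarz)
    also have "\<dots> \<le> norm w * K" using g_bound by (intro mult_left_mono) auto
    finally show ?thesis .
  qed
  hence "2 * c * norm w \<le> K" using pos by (cases "norm w = 0") auto
  moreover have "0 \<le> c * norm w" "0 \<le> C * r" using pos by simp_all
  ultimately have "c * norm w \<le> K + C * r" by linarith
  hence "k * (c * norm w) \<le> k * (K + C * r)" using pos by (intro mult_left_mono) auto
  hence "k * norm w \<le> R" using pos by (simp add: R_def field_simps)
  hence u: "norm u \<le> R / n" using pos by (simp add: u_def field_simps)
  hence ur: "norm u \<le> r" using Rn by linarith
  have "g \<bullet> u - n / k / 2 * (u \<bullet> (H *v u)) = V"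
    using pos by (simp add: u_def V_def matrix_vector_mult_scaleR w inner_commute field_simps)
  moreover have "n / k * D (x + u) \<le> n / k * (1 / 2 * (u \<bullet> (H *v u)) + C * norm u ^ 3)"
    using D_expansion[OF ur] pos by (intro mult_left_mono) auto
  hence "n / k * D (x + u) \<le> n / k / 2 * (u \<bullet> (H *v u)) + n / k * (C * norm u ^ 3)"
    by (simp add: algebra_simps)
  moreover have "m x + g \<bullet> u - C * (norm u)\<^sup>2 \<le> m (x + u)" using m_expansion[OF ur] by auto
  ultimately have lower: "m x + V - E \<le> m (x + u) - n / k * D (x + u)"
    using small_error[OF u] by linarith
  have xu: "x + u \<in> \<Theta>" by (rule ball[OF ur])
  have "(SUP y\<in>\<Theta>. m y - n / k * D y) \<le> m x + V + E"
    using xu upper by (intro cSUP_least) auto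
  \<comment> \<open>The upper estimate also provides the boundedness without which a real supremum
    need not dominate its members.\<close>
  moreover have "m (x + u) - n / k * D (x + u) \<le> (SUP y\<in>\<Theta>. m y - n / k * D y)"
    using upper xu by (intro cSUP_upper) (auto intro!: bdd_aboveI2)
  ultimately have "\<bar>(SUP y\<in>\<Theta>. m y - n / k * D y) - (m x + V)\<bar> \<le> E" using lower by linarith
  thus ?thesis unfolding V_def E_def w_def .
qed

section \<open>The log-partition function\<close>

context exponential_family
begin

text \<open>The measures \<open>Q \<theta>\<close> are unconstrained off \<Theta>, so the mean
  agrees with its quotient of moments on \<Theta> only; as \<Theta> is open, derivatives at its
  points do not see the difference.\<close>

lemma partials_cong:
  assumes "has_partials f f'" "\<And>\<theta>. \<theta> \<in> \<Theta> \<Longrightarrow> g \<theta> = f \<theta>"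
  shows "has_partials g f'"
  using assms open_params unfolding has_partials_def
  by (metis (no_types, lifting) has_derivative_transform_within_open)

lemma partials_gradient:
  assumes "has_partials f f'" "\<theta> \<in> \<Theta>"
  shows "gradient f \<theta> = (\<chi> i. f' i \<theta>)"
  unfolding gradient_def
proof (rule the_equality)
  show G: "GDERIV f \<theta> :> (\<chi> i. f' i \<theta>)"
    using assms unfolding gderiv_def has_partials_def by (simp add: inner_vec_def mult.commute)
  fix D assume "GDERIV f \<theta> :> D"
  hence "(\<lambda>u. u \<bullet> D) = (\<lambda>u. u \<bullet> (\<chi> i. f' i \<theta>))"
    using G unfolding gderiv_def by (rule has_derivative_unique)
  hence "\<forall>u. u \<bullet> D = u \<bullet> (\<chi> i. f' i \<theta>)" by (simp add: fun_eq_iff)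
  thus "D = (\<chi> i. f' i \<theta>)" by (simp add: vector_eq_ldot)
qed

lemma partials_hessian:
  assumes f: "has_partials f f'" "\<And>i. has_partials (f' i) (f'' i)" and \<theta>: "\<theta> \<in> \<Theta>"
  shows "hessian f \<theta> = (\<chi> i j. f'' i j \<theta>)"
proof -
  have "((\<lambda>\<theta>. \<chi> i. f' i \<theta>) has_derivative (\<lambda>u. \<chi> i. \<Sum>j\<in>UNIV. f'' i j \<theta> * u $ j)) (at \<theta>)"
    using f(2) \<theta> unfolding has_partials_def
    by (subst has_derivative_componentwise_within) (auto simp: Basis_vec_def inner_axis)
  moreover have "(\<lambda>u. \<chi> i. \<Sum>j\<in>UNIV. f'' i j \<theta> * u $ j) = (*v) (\<chi> i j. f'' i j \<theta>)"
    by (simp add: fun_eq_iff matrix_vector_mult_def)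
  ultimately have "(gradient f has_derivative (*v) (\<chi> i j. f'' i j \<theta>)) (at \<theta>)"
    using partials_gradient[OF f(1)] open_params \<theta>
    by (metis (no_types, lifting) has_derivative_transform_within_open)
  hence "frechet_derivative (gradient f) (at \<theta>) = (*v) (\<chi> i j. f'' i j \<theta>)"
    by (rule frechet_derivative_at[symmetric])
  thus ?thesis by (simp add: hessian_def jacobian_def matrix_of_matrix_vector_mul)
qed

section \<open>First and second derivatives of the log-partition function\<close>

lemma one_tame: "(\<lambda>_. 1) \<in> tame"
  by (rule bounded_tame[where b = 1]) auto

lemma T_tame: "(\<lambda>x. T x $ i) \<in> tame"
  using tame_times[OF one_tame, of i] by simp

abbreviation partition_function :: "real ^ 'd \<Rightarrow> real"
  where "partition_function \<equiv> moment (\<lambda>_. 1)"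

lemma partition_positive: "\<theta> \<in> \<Theta> \<Longrightarrow> 0 < partition_function \<theta>"
  using partition_pos[of \<theta>] by (simp add: moment_def)

lemma partition_nonzero: "\<theta> \<in> \<Theta> \<Longrightarrow> partition_function \<theta> \<noteq> 0"
  using partition_positive[of \<theta>] by simp

lemma log_partition_eq: "log_partition \<mu> h T \<theta> = ln (partition_function \<theta>)"
  by (simp add: log_partition_def moment_def)

text \<open>The expectation of the i-th component of T.\<close>

definition log_partition' :: "'d \<Rightarrow> real ^ 'd \<Rightarrow> real"
  where "log_partition' i \<theta> = moment (\<lambda>x. T x $ i) \<theta> * inverse (partition_function \<theta>)"

text \<open>The covariance of the components i and j of T, in the literal shape produced by the
  product and reciprocal rules.\<close>

definition log_partition'' :: "'d \<Rightarrow> 'd \<Rightarrow> real ^ 'd \<Rightarrow> real"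
  where "log_partition'' i j \<theta> =
    moment (\<lambda>x. T x $ i) \<theta> * - (moment (\<lambda>x. T x $ j) \<theta> * (inverse (partition_function \<theta>) * inverse (partition_function \<theta>)))
    + moment (\<lambda>x. T x $ i * T x $ j) \<theta> * inverse (partition_function \<theta>)"

lemma partition_partials: "has_partials partition_function (\<lambda>i. moment (\<lambda>x. T x $ i))"
  using moment_partials[OF one_tame] by simp

lemma log_partition_partials: "has_partials (log_partition \<mu> h T) log_partition'"
  unfolding has_partials_def
proof
  fix \<theta> assume \<theta>: "\<theta> \<in> \<Theta>"
  have "((\<lambda>\<theta>. ln (partition_function \<theta>)) has_derivative (\<lambda>u. \<Sum>i\<in>UNIV. log_partition' i \<theta> * u $ i)) (at \<theta>)"
    using partition_partials partition_positive[OF \<theta>] \<theta> unfolding has_partials_def log_partition'_def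
    by (auto intro!: derivative_eq_intros simp: sum_distrib_left mult_ac divide_inverse)
  thus "(log_partition \<mu> h T has_derivative (\<lambda>u. \<Sum>i\<in>UNIV. log_partition' i \<theta> * u $ i)) (at \<theta>)"
    by (simp add: log_partition_eq[abs_def])
qed

lemma log_partition'_partials: "has_partials (log_partition' i) (log_partition'' i)"
  unfolding log_partition'_def[abs_def] log_partition''_def[abs_def]
  by (intro mult_partials moment_partials inverse_partials partition_partials T_tame partition_nonzero)

lemma log_partition''_smooth: "log_partition'' i j \<in> smooth_algebra"
  unfolding log_partition''_def[abs_def]
  by (intro smooth_algebra.intros T_tame tame_times one_tame partition_nonzero)

lemma log_partition''_commute: "log_partition'' i j \<theta> = log_partition'' j i \<theta>"
  by (simp add: log_partition''_def mult_ac)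

lemma log_partition_hessian:
  "\<theta> \<in> \<Theta> \<Longrightarrow> hessian (log_partition \<mu> h T) \<theta> = (\<chi> i j. log_partition'' i j \<theta>)"
  by (rule partials_hessian[OF log_partition_partials log_partition'_partials])

text \<open>\<open>\<Theta>\<close> need not be convex, so the intermediate point is a hypothesis.\<close>

lemma log_partition_convex:
  assumes x: "x \<in> \<Theta>" and y: "y \<in> \<Theta>" and z: "x + s *\<^sub>R (y - x) \<in> \<Theta>" and s: "0 \<le> s" "s \<le> 1"
  defines "A \<equiv> log_partition \<mu> h T"
  shows "A (x + s *\<^sub>R (y - x)) \<le> (1 - s) * A x + s * A y"
proof -
  define z where "z = x + s *\<^sub>R (y - x)"
  note ints = partition_integrable[OF x] partition_integrable[OF y]
  have normalized: "(\<integral>t. h t * exp (v \<bullet> T t) \<partial>\<mu>) = exp (A v)" if "v \<in> \<Theta>" for v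
    using partition_pos[OF that] by (simp add: A_def log_partition_def)
  have "exp (A z) = (\<integral>t. h t * exp (z \<bullet> T t) \<partial>\<mu>)" using z by (simp add: normalized z_def)
  also have "\<dots> \<le> (\<integral>t. exp ((1 - s) * A x + s * A y) *
      ((1 - s) * exp (- A x) * (h t * exp (x \<bullet> T t)) + s * exp (- A y) * (h t * exp (y \<bullet> T t))) \<partial>\<mu>)"
  proof (rule Bochner_Integration.integral_mono)
    fix t assume t: "t \<in> space \<mu>"
    \<comment> \<open>Normalizing both exponents lets convexity of exp take the place of Hoelder's
      inequality: \<open>h t * exp a\<close> and \<open>h t * exp b\<close> integrate to 1, so the
      convex combination does too and only the constant F remains.\<close>
    define a b where "a = x \<bullet> T t - A x" and "b = y \<bullet> T t - A y"
    have conv: "exp ((1 - s) * a + s * b) \<le> (1 - s) * exp a + s * exp b"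
      using convex_onD[OF exp_convex, of s a b] s by simp
    define F where "F = exp ((1 - s) * A x + s * A y)"
    have "h t * exp (z \<bullet> T t) = h t * F * exp ((1 - s) * a + s * b)"
      by (simp add: F_def a_def b_def z_def inner_add_left inner_diff_left algebra_simps flip: exp_add)
    also have "\<dots> \<le> h t * F * ((1 - s) * exp a + s * exp b)"
      using h_nonneg[OF t] conv by (intro mult_left_mono) (auto simp: F_def)
    also have "\<dots> = F * ((1 - s) * exp (- A x) * (h t * exp (x \<bullet> T t)) + s * exp (- A y) * (h t * exp (y \<bullet> T t)))"
      by (simp add: a_def b_def exp_diff exp_minus divide_inverse distrib_left mult_ac)
    finally show "h t * exp (z \<bullet> T t) \<le> exp ((1 - s) * A x + s * A y) *
      ((1 - s) * exp (- A x) * (h t * exp (x \<bullet> T t)) + s * exp (- A y) * (h t * exp (y \<bullet> T t)))"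
      unfolding F_def .
  qed (use ints partition_integrable[OF z] in \<open>auto simp: z_def\<close>)
  also have "\<dots> = exp ((1 - s) * A x + s * A y)"
    using ints x y by (simp add: normalized mult.assoc flip: exp_add)
  finally show ?thesis by (simp add: z_def)
qed

text \<open>The Kullback-Leibler divergence KL(Q^x || Q^y) of the family, as the Bregman divergence
  of its log-partition function.\<close>

definition bregman :: "real ^ 'd \<Rightarrow> real ^ 'd \<Rightarrow> real"
  where "bregman x y = log_partition \<mu> h T y - log_partition \<mu> h T x
    - (\<Sum>i\<in>UNIV. log_partition' i x * (y - x) $ i)"

text \<open>Zero at x and convex along rays, the Bregman divergence grows at least linearly; a lower
  bound on a small sphere therefore carries over to everything behind it.\<close>

lemma bregman_segment:
  assumes "x \<in> \<Theta>" "x + v \<in> \<Theta>" "x + s *\<^sub>R v \<in> \<Theta>" "0 \<le> s" "s \<le> 1"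
  shows "bregman x (x + s *\<^sub>R v) \<le> s * bregman x (x + v)"
  using log_partition_convex[of x "x + v" s] assms
  by (simp add: bregman_def sum_distrib_left algebra_simps)

lemma local_expansions:
  assumes \<theta>0: "\<theta>0 \<in> \<Theta>" and pd: "positive_definite (hessian (log_partition \<mu> h T) \<theta>0)"
    and m: "has_partials m m'" "\<And>i. m' i \<in> smooth_algebra"
  obtains r c C K where "0 < r" "0 < c" "0 \<le> C" "0 \<le> K"
    "\<And>x u. dist \<theta>0 x \<le> r \<Longrightarrow> norm u \<le> r \<Longrightarrow> x + u \<in> \<Theta>"
    "\<And>x u. dist \<theta>0 x \<le> r \<Longrightarrow> norm u \<le> r \<Longrightarrow> \<bar>m (x + u) - m x - gradient m x \<bullet> u\<bar> \<le> C * (norm u)\<^sup>2"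
    "\<And>x. dist \<theta>0 x \<le> r \<Longrightarrow> norm (gradient m x) \<le> K"
    "\<And>x u. dist \<theta>0 x \<le> r \<Longrightarrow> norm u \<le> r \<Longrightarrow>
      \<bar>bregman x (x + u) - 1 / 2 * (u \<bullet> (hessian (log_partition \<mu> h T) x *v u))\<bar> \<le> C * norm u ^ 3"
    "\<And>x u. dist \<theta>0 x \<le> r \<Longrightarrow> norm u \<le> r \<Longrightarrow> c * (norm u)\<^sup>2 \<le> bregman x (x + u)"
    "\<And>x y. dist \<theta>0 x \<le> r \<Longrightarrow> y \<in> \<Theta> \<Longrightarrow> r < norm (y - x) \<Longrightarrow> c * r\<^sup>2 \<le> bregman x y"
    "\<And>x. dist \<theta>0 x \<le> r \<Longrightarrow>
      transpose (hessian (log_partition \<mu> h T) x) = hessian (log_partition \<mu> h T) x"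
    "\<And>x u. dist \<theta>0 x \<le> r \<Longrightarrow>
      2 * c * (norm u)\<^sup>2 \<le> u \<bullet> (hessian (log_partition \<mu> h T) x *v u)"
proof -
  obtain R where R: "R > 0" "cball \<theta>0 R \<subseteq> \<Theta>" using open_params \<theta>0 open_contains_cball by blast
  define S where "S = cball \<theta>0 R"
  have S: "compact S" "convex S" "S \<subseteq> \<Theta>" using R by (auto simp: S_def)
  define H where "H x = hessian (log_partition \<mu> h T) x" for x
  have H: "H x = (\<chi> i j. log_partition'' i j x)" if "x \<in> S" for x
    using log_partition_hessian that S(3) by (auto simp: H_def)
  have H_form: "u \<bullet> (H x *v u) = (\<Sum>i\<in>UNIV. (\<Sum>j\<in>UNIV. log_partition'' i j x * u $ j) * u $ i)"
    if "x \<in> S" for x u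
    by (simp add: H[OF that] inner_vec_def matrix_vector_mult_def mult.commute)
  have "\<exists>B. B \<ge> 0 \<and> (\<forall>z\<in>S. \<bar>m' i z\<bar> \<le> B)" for i
    using smooth_algebra_bounded[OF m(2) S(1,3)] by metis
  then obtain B where B: "\<And>i. B i \<ge> 0" "\<And>i z. z \<in> S \<Longrightarrow> \<bar>m' i z\<bar> \<le> B i" by metis
  define K where "K = (\<Sum>i\<in>UNIV. B i)"
  have "\<exists>L. L \<ge> 0 \<and> (\<forall>x\<in>S. \<forall>y\<in>S. \<bar>log_partition'' i j y - log_partition'' i j x\<bar> \<le> L * norm (y - x))"
    for i j using smooth_algebra_lipschitz[OF log_partition''_smooth S] by metis
  then obtain l where l: "\<And>i j. l i j \<ge> 0"
    "\<And>i j x y. x \<in> S \<Longrightarrow> y \<in> S \<Longrightarrow> \<bar>log_partition'' i j y - log_partition'' i j x\<bar> \<le> l i j * norm (y - x)"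
    by metis
  define L where "L = (\<Sum>i\<in>UNIV. \<Sum>j\<in>UNIV. l i j)"
  have L: "L \<ge> 0" using l(1) by (simp add: L_def sum_nonneg)
  obtain Cm where Cm: "Cm \<ge> 0" "\<And>x y. x \<in> S \<Longrightarrow> y \<in> S \<Longrightarrow>
    \<bar>m y - m x - (\<Sum>i\<in>UNIV. m' i x * (y - x) $ i)\<bar> \<le> Cm * (norm (y - x))\<^sup>2"
    using smooth_algebra_linearization[OF m S] by blast
  obtain CA where CA: "CA \<ge> 0" "\<And>x v. x \<in> S \<Longrightarrow> x + v \<in> S \<Longrightarrow>
    \<bar>log_partition \<mu> h T (x + v) - log_partition \<mu> h T x - (\<Sum>i\<in>UNIV. log_partition' i x * v $ i)
      - 1 / 2 * (\<Sum>i\<in>UNIV. (\<Sum>j\<in>UNIV. log_partition'' i j x * v $ j) * v $ i)\<bar> \<le> CA * norm v ^ 3"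
    using smooth_algebra_taylor2[OF log_partition_partials log_partition'_partials log_partition''_smooth S]
    by blast
  define C where "C = max Cm CA"
  \<comment> \<open>Compactness of the unit sphere turns positive definiteness at
    \<open>\<theta>0\<close> into a quantitative bound with constant \<kappa>.\<close>
  have "continuous_on (sphere 0 1) (\<lambda>u. u \<bullet> (H \<theta>0 *v u))"
    by (intro continuous_intros matrix_vector_mult_linear_continuous_on)
  then obtain u0 where u0: "norm u0 = 1"
    "\<And>u. norm u = 1 \<Longrightarrow> u0 \<bullet> (H \<theta>0 *v u0) \<le> u \<bullet> (H \<theta>0 *v u)"
    using continuous_attains_inf[of "sphere (0 :: real ^ 'd) 1" "\<lambda>u. u \<bullet> (H \<theta>0 *v u)"] by auto
  define \<kappa> where "\<kappa> = u0 \<bullet> (H \<theta>0 *v u0)"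
  have \<kappa>: "\<kappa> > 0" using pd u0(1) unfolding positive_definite_def \<kappa>_def H_def by (metis norm_zero zero_neq_one)
  have H0: "\<kappa> * (norm u)\<^sup>2 \<le> u \<bullet> (H \<theta>0 *v u)" for u
  proof (cases "u = 0")
    case False
    define w where "w = (1 / norm u) *\<^sub>R u"
    have w: "norm w = 1" "u = norm u *\<^sub>R w" using False by (simp_all add: w_def)
    have "u \<bullet> (H \<theta>0 *v u) = (norm u)\<^sup>2 * (w \<bullet> (H \<theta>0 *v w))"
      by (subst (1 2) w(2)) (simp add: matrix_vector_mult_scaleR power2_eq_square)
    moreover have "(norm u)\<^sup>2 * \<kappa> \<le> (norm u)\<^sup>2 * (w \<bullet> (H \<theta>0 *v w))"
      unfolding \<kappa>_def by (intro mult_left_mono u0(2) w(1)) simp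
    ultimately show ?thesis by (simp add: mult.commute)
  qed simp
  \<comment> \<open>Budget for \<kappa>: moving the Hessian from \<open>\<theta>0\<close> to x costs
    at most half, leaving \<open>4 * c\<close>; the Taylor factor 1/2 leaves \<open>2 * c\<close>,
    and the cubic remainder takes one more c. The last two terms of r enforce these losses, the
    first keeps x and \<open>x + u\<close> in S, and the added ones prevent division by
    zero.\<close>
  define c where "c = \<kappa> / 8"
  define r where "r = min (R / 2) (min (\<kappa> / (2 * (L + 1))) (c / (C + 1)))"
  have C: "C \<ge> 0" "Cm \<le> C" "CA \<le> C" using Cm(1) by (auto simp: C_def)
  have c: "c > 0" using \<kappa> by (simp add: c_def)
  have r: "r > 0" using R \<kappa> L c C by (simp add: r_def)
  have "r \<le> c / (C + 1)" by (simp add: r_def)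
  hence "r * (C + 1) \<le> c" using C by (simp add: pos_le_divide_eq)
  hence rC: "C * r \<le> c" using r by (simp add: algebra_simps)
  have "r \<le> \<kappa> / (2 * (L + 1))" by (simp add: r_def)
  hence "r * (2 * (L + 1)) \<le> \<kappa>" using L by (simp add: pos_le_divide_eq)
  hence rL: "L * r \<le> \<kappa> / 2" using r by (simp add: algebra_simps)
  have rR: "2 * r \<le> R" by (simp add: r_def)
  have near: "x + u \<in> S" if "dist \<theta>0 x \<le> r" "norm u \<le> r" for x u
  proof -
    have "dist \<theta>0 (x + u) \<le> dist \<theta>0 x + dist x (x + u)" by (rule dist_triangle)
    also have "dist x (x + u) = norm u" by (simp add: dist_norm)
    finally show ?thesis using that rR by (simp add: S_def)
  qed
  have near0: "x \<in> S" if "dist \<theta>0 x \<le> r" for x using near[OF that, of 0] r by simp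
  have grad: "gradient m x = (\<chi> i. m' i x)" if "dist \<theta>0 x \<le> r" for x
    using partials_gradient[OF m(1)] near0[OF that] S(3) by blast
  have H_coercive: "4 * c * (norm u)\<^sup>2 \<le> u \<bullet> (H x *v u)" if x: "dist \<theta>0 x \<le> r" for x u
  proof -
    have \<theta>0S: "\<theta>0 \<in> S" using R by (simp add: S_def)
    have "u \<bullet> (H x *v u) - u \<bullet> (H \<theta>0 *v u)
        = (\<Sum>i\<in>UNIV. \<Sum>j\<in>UNIV. (log_partition'' i j x - log_partition'' i j \<theta>0) * (u $ j * u $ i))"
      unfolding H_form[OF near0[OF x]] H_form[OF \<theta>0S]
      by (simp add: sum_subtractf left_diff_distrib sum_distrib_right mult.assoc)
    also have "norm \<dots> \<le> (\<Sum>i\<in>UNIV. \<Sum>j\<in>UNIV. l i j * (r * (norm u)\<^sup>2))"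
    proof (intro sum_norm_le)
      fix i j
      have "\<bar>log_partition'' i j x - log_partition'' i j \<theta>0\<bar> \<le> l i j * norm (x - \<theta>0)"
        by (rule l(2)[OF \<theta>0S near0[OF x]])
      also have "\<dots> \<le> l i j * r"
        using x l(1) by (intro mult_left_mono) (auto simp: dist_norm norm_minus_commute)
      finally have "\<bar>log_partition'' i j x - log_partition'' i j \<theta>0\<bar> \<le> l i j * r" .
      moreover have "\<bar>u $ j\<bar> * \<bar>u $ i\<bar> \<le> norm u * norm u"
        by (intro mult_mono) (auto simp: component_le_norm_cart)
      ultimately have "\<bar>log_partition'' i j x - log_partition'' i j \<theta>0\<bar> * \<bar>u $ j * u $ i\<bar>
          \<le> l i j * r * (norm u * norm u)"
        using l(1)[of i j] r unfolding abs_mult[of "u $ j"] by - (rule mult_mono, simp_all)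
      thus "norm ((log_partition'' i j x - log_partition'' i j \<theta>0) * (u $ j * u $ i)) \<le> l i j * (r * (norm u)\<^sup>2)"
        by (simp only: real_norm_def abs_mult power2_eq_square mult.assoc)
    qed
    also have "\<dots> = L * r * (norm u)\<^sup>2" by (simp add: L_def sum_distrib_right mult.assoc)
    also have "\<dots> \<le> \<kappa> / 2 * (norm u)\<^sup>2" using rL by (rule mult_right_mono) simp
    finally have "\<bar>u \<bullet> (H x *v u) - u \<bullet> (H \<theta>0 *v u)\<bar> \<le> \<kappa> / 2 * (norm u)\<^sup>2" by simp
    moreover have "4 * c * (norm u)\<^sup>2 = \<kappa> * (norm u)\<^sup>2 - \<kappa> / 2 * (norm u)\<^sup>2" by (simp add: c_def)
    ultimately show ?thesis using H0[of u] by linarith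
  qed
  have breg: "\<bar>bregman x (x + u) - 1 / 2 * (u \<bullet> (H x *v u))\<bar> \<le> C * norm u ^ 3"
    if x: "dist \<theta>0 x \<le> r" and u: "norm u \<le> r" for x u
  proof -
    have "\<bar>bregman x (x + u) - 1 / 2 * (u \<bullet> (H x *v u))\<bar> \<le> CA * norm u ^ 3"
      using CA(2)[OF near0[OF x] near[OF x u]] by (simp add: bregman_def H_form[OF near0[OF x]])
    also have "\<dots> \<le> C * norm u ^ 3" using C by (intro mult_right_mono) auto
    finally show ?thesis .
  qed
  have breg_near: "c * (norm u)\<^sup>2 \<le> bregman x (x + u)"
    if x: "dist \<theta>0 x \<le> r" and u: "norm u \<le> r" for x u
  proof -
    have "C * norm u ^ 3 = C * norm u * (norm u)\<^sup>2" by (simp add: power2_eq_square power3_eq_cube)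
    also have "\<dots> \<le> C * r * (norm u)\<^sup>2" using u C by (intro mult_right_mono mult_left_mono) auto
    also have "\<dots> \<le> c * (norm u)\<^sup>2" using rC by (rule mult_right_mono) simp
    finally show ?thesis using breg[OF x u] H_coercive[OF x, of u] by linarith
  qed
  show thesis
  proof (rule that[OF r c C(1)])
    show "0 \<le> K" using B(1) by (simp add: K_def sum_nonneg)
    show "x + u \<in> \<Theta>" if "dist \<theta>0 x \<le> r" "norm u \<le> r" for x u
      using near[OF that] S(3) by blast
    show "\<bar>m (x + u) - m x - gradient m x \<bullet> u\<bar> \<le> C * (norm u)\<^sup>2"
      if x: "dist \<theta>0 x \<le> r" and u: "norm u \<le> r" for x u
    proof -
      have "\<bar>m (x + u) - m x - gradient m x \<bullet> u\<bar> \<le> Cm * (norm u)\<^sup>2"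
        using Cm(2)[OF near0[OF x] near[OF x u]] by (simp add: grad[OF x] inner_vec_def)
      also have "\<dots> \<le> C * (norm u)\<^sup>2" using C by (intro mult_right_mono) auto
      finally show ?thesis .
    qed
    show "norm (gradient m x) \<le> K" if x: "dist \<theta>0 x \<le> r" for x
    proof -
      have "norm (gradient m x) \<le> (\<Sum>i\<in>UNIV. \<bar>gradient m x $ i\<bar>)" by (rule norm_le_l1_cart)
      also have "\<dots> \<le> K" unfolding K_def using B(2)[OF near0[OF x]] by (intro sum_mono) (simp add: grad[OF x])
      finally show ?thesis .
    qed
    show "c * r\<^sup>2 \<le> bregman x y" if x: "dist \<theta>0 x \<le> r" and y: "y \<in> \<Theta>" and far: "r < norm (y - x)" for x y
    proof -
      define v where "v = y - x"
      \<comment> \<open>Places \<open>x + s *\<^sub>R v\<close> on the sphere of radius r, which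
        lies in \<Theta> even if the rest of the segment does not.\<close>
      define s where "s = r / norm v"
      have v: "r < norm v" using far by (simp add: v_def)
      have "0 < norm v" using r v by linarith
      hence s: "0 < s" "s \<le> 1" using r v by (simp_all add: s_def)
      have sv: "norm (s *\<^sub>R v) = r" using r \<open>0 < norm v\<close> by (simp add: s_def)
      have "c * r\<^sup>2 \<le> bregman x (x + s *\<^sub>R v)" using breg_near[OF x, of "s *\<^sub>R v"] sv by simp
      also have "\<dots> \<le> s * bregman x (x + v)"
        using near[OF x, of "s *\<^sub>R v"] near0[OF x] sv S(3) y s
        by (intro bregman_segment) (auto simp: v_def)
      finally have *: "c * r\<^sup>2 \<le> s * bregman x y" by (simp add: v_def)
      moreover have "0 < c * r\<^sup>2" using c r by simp
      \<comment> \<open>Positivity has to come first: only then does \<open>s \<le> 1\<close> allow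
        the factor s to be dropped.\<close>
      ultimately have "0 < s * bregman x y" by linarith
      hence "0 < bregman x y" using s(1) by (simp add: zero_less_mult_iff)
      hence "s * bregman x y \<le> 1 * bregman x y" using s(2) by (intro mult_right_mono) auto
      thus ?thesis using * by linarith
    qed
    show "transpose (hessian (log_partition \<mu> h T) x) = hessian (log_partition \<mu> h T) x"
      if x: "dist \<theta>0 x \<le> r" for x
      using H[OF near0[OF x]] log_partition''_commute by (simp add: H_def transpose_def vec_eq_iff)
    show "2 * c * (norm u)\<^sup>2 \<le> u \<bullet> (hessian (log_partition \<mu> h T) x *v u)" if x: "dist \<theta>0 x \<le> r" for x u
    proof -
      have "2 * c * (norm u)\<^sup>2 \<le> 4 * c * (norm u)\<^sup>2" using c by (intro mult_right_mono) auto
      thus ?thesis using H_coercive[OF x, of u] by (simp add: H_def)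
    qed
  qed (use breg breg_near in \<open>auto simp: H_def\<close>)
qed

end

section \<open>Events of high probability\<close>

text \<open>Measurable covers of equal measure reduce this to subadditivity of the measure
  itself.\<close>

lemma outer_measure_of_Un_le:
  assumes "A \<subseteq> space M" "B \<subseteq> space M"
  shows "outer_measure_of M (A \<union> B) \<le> outer_measure_of M A + outer_measure_of M B"
proof -
  obtain A' B' where A': "A' \<in> sets M" "A \<subseteq> A'" "outer_measure_of M A = emeasure M A'"
    and B': "B' \<in> sets M" "B \<subseteq> B'" "outer_measure_of M B = emeasure M B'"
    using outer_measure_of_attain assms by metis
  have "outer_measure_of M (A \<union> B) \<le> outer_measure_of M (A' \<union> B')"
    using A' B' by (intro outer_measure_of_mono) auto
  also have "\<dots> = emeasure M (A' \<union> B')" using A' B' by simp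
  also have "\<dots> \<le> emeasure M A' + emeasure M B'" using A' B' by (intro emeasure_subadditive)
  finally show ?thesis using A' B' by simp
qed

lemma outer_measure_of_AE:
  assumes "AE x in M. P x"
  shows "outer_measure_of M {x \<in> space M. \<not> P x} = 0"
proof -
  from AE_E[OF assms] obtain N where N: "{x \<in> space M. \<not> P x} \<subseteq> N" "emeasure M N = 0" "N \<in> sets M"
    by auto
  have "outer_measure_of M {x \<in> space M. \<not> P x} \<le> outer_measure_of M N"
    using N by (intro outer_measure_of_mono) auto
  thus ?thesis using N by simp
qed

lemma whp_conj:
  assumes "whp P E" "whp P F"
  shows "whp P (\<lambda>N \<omega>. E N \<omega> \<and> F N \<omega>)"
  unfolding whp_def
proof (rule tendsto_sandwich[OF _ _ tendsto_const])
  show "(\<lambda>N. outer_measure_of P {\<omega> \<in> space P. \<not> E N \<omega>} + outer_measure_of P {\<omega> \<in> space P. \<not> F N \<omega>})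
      \<longlonglongrightarrow> 0"
    using tendsto_add[OF assms[unfolded whp_def]] by simp
  have "{\<omega> \<in> space P. \<not> (E N \<omega> \<and> F N \<omega>)} = {\<omega> \<in> space P. \<not> E N \<omega>} \<union> {\<omega> \<in> space P. \<not> F N \<omega>}" for N
    by auto
  thus "\<forall>\<^sub>F N in sequentially. outer_measure_of P {\<omega> \<in> space P. \<not> (E N \<omega> \<and> F N \<omega>)}
      \<le> outer_measure_of P {\<omega> \<in> space P. \<not> E N \<omega>} + outer_measure_of P {\<omega> \<in> space P. \<not> F N \<omega>}"
    by (intro always_eventually allI) (auto intro!: outer_measure_of_Un_le)
qed simp

lemma whp_AE: "AE \<omega> in P. E \<omega> \<Longrightarrow> whp P (\<lambda>_. E)"
  by (simp add: whp_def outer_measure_of_AE)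

lemma whp_dist_le: "tendsto_in_prob P Y l \<Longrightarrow> \<epsilon> > 0 \<Longrightarrow> whp P (\<lambda>N \<omega>. dist (Y N \<omega>) l \<le> \<epsilon>)"
  by (simp add: tendsto_in_prob_def whp_def not_le)

text \<open>Once M reaches C, the event of the definition lies in the complement of E for all
  \<open>N \<ge> m\<close>, so the limit superior is exactly zero and not merely small.\<close>

lemma big_O_probI:
  assumes "whp P E"
    and bound: "\<And>N \<omega>. m \<le> N \<Longrightarrow> \<omega> \<in> space P \<Longrightarrow> E N \<omega> \<Longrightarrow> \<bar>Y N \<omega> / g N\<bar> \<le> C"
  shows "big_O_prob P Y g"
  unfolding big_O_prob_def
proof (rule tendsto_eventually, rule eventually_at_top_linorderI[of C])
  fix M assume M: "C \<le> M"
  have "limsup (\<lambda>N. outer_measure_of P {\<omega> \<in> space P. \<bar>Y N \<omega> / g N\<bar> > M})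
      \<le> limsup (\<lambda>N. outer_measure_of P {\<omega> \<in> space P. \<not> E N \<omega>})"
  proof (rule Limsup_mono, rule eventually_sequentiallyI[of m])
    fix N assume "m \<le> N"
    thus "outer_measure_of P {\<omega> \<in> space P. \<bar>Y N \<omega> / g N\<bar> > M} \<le> outer_measure_of P {\<omega> \<in> space P. \<not> E N \<omega>}"
      using bound M by (intro outer_measure_of_mono) force
  qed
  also have "\<dots> = 0" using assms(1) unfolding whp_def by (intro lim_imp_Limsup) simp_all
  finally show "limsup (\<lambda>N. outer_measure_of P {\<omega> \<in> space P. \<bar>Y N \<omega> / g N\<bar> > M}) = 0" by simp
qed

section \<open>Reduction to a deterministic optimization problem\<close>

context exponential_family
begin

lemma ef_density_eq:
  "\<theta> \<in> \<Theta> \<Longrightarrow> ef_density \<mu> h T \<theta> x = h x * exp (\<theta> \<bullet> T x) * inverse (partition_function \<theta>)"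
  using partition_positive[of \<theta>]
  by (simp add: ef_density_def log_partition_eq exp_diff divide_inverse)

lemma likelihood_eq:
  "likelihood \<mu> h T Xs N \<theta> \<omega> =
    (\<Prod>n<N. h (Xs n \<omega>)) * exp (\<theta> \<bullet> (\<Sum>n<N. T (Xs n \<omega>)) - real N * log_partition \<mu> h T \<theta>)"
  by (simp add: likelihood_def ef_density_def prod.distrib sum_subtractf inner_sum_right flip: exp_sum)

text \<open>Positivity of h makes \<open>ln p\<close> a genuine additive constant, common to all
  parameters, which cancels in the divergence.\<close>

lemma divergence_eq_bregman:
  assumes mle: "is_mle \<Theta> \<mu> h T Xs N \<omega> x" and pos: "\<And>n. h (Xs n \<omega>) > 0" and y: "y \<in> \<Theta>"
  shows "divergence \<Theta> \<mu> h T Xs N y \<omega> = real N * bregman x y"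
proof -
  define A where "A = log_partition \<mu> h T"
  define s where "s = (\<Sum>n<N. T (Xs n \<omega>))"
  define l where "l z = z \<bullet> s - real N * A z" for z
  define p where "p = (\<Prod>n<N. h (Xs n \<omega>))"
  have p: "p > 0" unfolding p_def using pos by (intro prod_pos) auto
  have lik: "likelihood \<mu> h T Xs N z \<omega> = p * exp (l z)" for z
    by (simp add: likelihood_eq p_def l_def A_def s_def)
  have ln_lik: "ln (likelihood \<mu> h T Xs N z \<omega>) = ln p + l z" for z
    using p by (simp add: lik ln_mult)
  have x: "x \<in> \<Theta>" using mle by (simp add: is_mle_def)
  have max: "l z \<le> l x" if "z \<in> \<Theta>" for z
    using mle that p by (simp add: is_mle_def lik)
  \<comment> \<open>The maximizer attains the supremum, so the real-valued SUP has its intended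
    value.\<close>
  have "(SUP z\<in>\<Theta>. ln (likelihood \<mu> h T Xs N z \<omega>)) = ln p + l x"
    unfolding ln_lik using x max by (intro cSup_eq_maximum) auto
  hence div: "divergence \<Theta> \<mu> h T Xs N y \<omega> = l x - l y"
    by (simp add: divergence_def ln_lik)
  have "(l has_derivative (\<lambda>u. u \<bullet> s - real N * (\<Sum>i\<in>UNIV. log_partition' i x * u $ i))) (at x)"
    using log_partition_partials x unfolding l_def[abs_def] A_def has_partials_def
    by (auto intro!: derivative_eq_intros)
  hence "(\<lambda>u. u \<bullet> s - real N * (\<Sum>i\<in>UNIV. log_partition' i x * u $ i)) = (\<lambda>_. 0)"
    using max by (intro differential_zero_maxmin[OF x open_params]) auto
  hence "(y - x) \<bullet> s - real N * (\<Sum>i\<in>UNIV. log_partition' i x * (y - x) $ i) = 0"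
    by (rule fun_cong)
  thus ?thesis unfolding div by (simp add: l_def bregman_def A_def algebra_simps)
qed

lemma dr_expectation_eq_bregman:
  assumes "is_mle \<Theta> \<mu> h T Xs N \<omega> x" "\<And>n. h (Xs n \<omega>) > 0"
  shows "dr_expectation \<Theta> \<mu> h T Xs k N (\<lambda>\<theta> _. m \<theta>) \<omega> = (SUP y\<in>\<Theta>. m y - real N / k * bregman x y)"
  unfolding dr_expectation_def
  by (intro SUP_cong refl) (simp add: divergence_eq_bregman[OF assms])

end

section \<open>Means and positivity under the sampling measures\<close>

context exponential_family_sample
begin

lemma mean_eq_moment:
  assumes "\<phi> \<in> borel_measurable \<mu>" "\<theta> \<in> \<Theta>"
  shows "mean Q X \<phi> \<theta> = moment \<phi> \<theta> * inverse (partition_function \<theta>)"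
proof -
  have "mean Q X \<phi> \<theta> = (\<integral>x. ef_density \<mu> h T \<theta> x * \<phi> x \<partial>\<mu>)"
    unfolding mean_def
    by (rule distributed_integral[symmetric, OF X_distributed assms(1)])
      (auto simp: assms ef_density_def h_nonneg)
  also have "\<dots> = (\<integral>x. \<phi> x * (h x * exp (\<theta> \<bullet> T x)) * inverse (partition_function \<theta>) \<partial>\<mu>)"
    by (simp add: ef_density_eq[OF assms(2)] mult_ac)
  also have "\<dots> = moment \<phi> \<theta> * inverse (partition_function \<theta>)" unfolding moment_def by simp
  finally show ?thesis .
qed

lemma mean_partials:
  assumes "\<phi> \<in> tame"
  obtains m' where "has_partials (mean Q X \<phi>) m'" "\<And>i. m' i \<in> smooth_algebra"
proof -
  have "\<phi> \<in> borel_measurable \<mu>" using assms by (simp add: tame_def)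
  moreover have "(\<lambda>\<theta>. moment \<phi> \<theta> * inverse (partition_function \<theta>)) \<in> smooth_algebra"
    by (intro smooth_algebra.intros assms one_tame partition_nonzero)
  then obtain m' where "has_partials (\<lambda>\<theta>. moment \<phi> \<theta> * inverse (partition_function \<theta>)) m'"
    "\<And>i. m' i \<in> smooth_algebra" using smooth_algebra_partials by blast
  ultimately show thesis using that partials_cong mean_eq_moment by blast
qed

lemma mean_bounded:
  assumes "\<theta> \<in> \<Theta>" "\<And>x. x \<in> space \<mu> \<Longrightarrow> \<bar>\<phi> x\<bar> \<le> b" "\<phi> \<in> borel_measurable \<mu>"
  shows "\<bar>mean Q X \<phi> \<theta>\<bar> \<le> b"
proof -
  interpret P: prob_space "Q \<theta>" by (rule prob_space_Q[OF assms(1)])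
  have X: "X \<in> measurable (Q \<theta>) \<mu>" using X_distributed[OF assms(1)] by (simp add: distributed_def)
  note b = assms(2)[OF measurable_space[OF X]]
  have "integrable (Q \<theta>) (\<lambda>\<omega>. \<phi> (X \<omega>))"
    using b by (intro P.integrable_const_bound[where B = b] measurable_compose[OF X assms(3)]) auto
  hence "\<bar>mean Q X \<phi> \<theta>\<bar> \<le> (\<integral>\<omega>. b \<partial>Q \<theta>)"
    unfolding mean_def real_norm_def[symmetric] using b
    by (intro order_trans[OF Bochner_Integration.integral_norm_bound] Bochner_Integration.integral_mono) auto
  thus ?thesis by (simp add: P.prob_space)
qed

text \<open>The density of an observation vanishes wherever h does, so each observation avoids that
  set almost surely; countably many null sets are then combined.\<close>

lemma AE_h_positive: "\<theta> \<in> \<Theta> \<Longrightarrow> AE \<omega> in Q \<theta>. \<forall>n. h (Xs n \<omega>) > 0"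
  unfolding AE_all_countable
proof
  fix n assume \<theta>: "\<theta> \<in> \<Theta>"
  have d: "Xs n \<in> measurable (Q \<theta>) \<mu>"
    "distr (Q \<theta>) \<mu> (Xs n) = density \<mu> (\<lambda>x. ennreal (ef_density \<mu> h T \<theta> x))"
    "(\<lambda>x. ennreal (ef_density \<mu> h T \<theta> x)) \<in> borel_measurable \<mu>"
    using Xs_distributed[OF \<theta>, of n] by (simp_all add: distributed_def)
  show "AE \<omega> in Q \<theta>. h (Xs n \<omega>) > 0"
  proof (rule AE_distrD[OF d(1)], unfold d(2) AE_density[OF d(3)], intro AE_I2 impI)
    fix x assume "0 < ennreal (ef_density \<mu> h T \<theta> x)"
    thus "0 < h x" by (simp add: ef_density_def zero_less_mult_iff)
  qed
qed

lemma space_Q: "\<theta> \<in> \<Theta> \<Longrightarrow> space (Q \<theta>) = space \<Omega>"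
  using sets_eq_imp_space_eq[OF sets_Q] .

end

theorem theorem4:
  fixes \<Theta> :: "(real ^ 'd) set"
    and \<mu> :: "'x measure"
    and h :: "'x \<Rightarrow> real"
    and T :: "'x \<Rightarrow> real ^ 'd"
    and \<Omega> :: "'w measure"
    and Q :: "real ^ 'd \<Rightarrow> 'w measure"
    and X :: "'w \<Rightarrow> 'x"
    and Xs :: "nat \<Rightarrow> 'w \<Rightarrow> 'x"
    and \<theta>hat :: "nat \<Rightarrow> 'w \<Rightarrow> real ^ 'd"
    and \<phi> :: "'x \<Rightarrow> real"
    and k :: real
    and \<theta>\<^sub>P :: "real ^ 'd"
  assumes family: "exponential_family_sample \<Theta> \<mu> h T \<Omega> Q X Xs"
    and info_pos: "\<And>\<theta>. \<theta> \<in> \<Theta> \<Longrightarrow> positive_definite (hessian (log_partition \<mu> h T) \<theta>)"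
    and mle_exists: "\<And>\<theta>. \<theta> \<in> \<Theta> \<Longrightarrow> whp (Q \<theta>) (\<lambda>N \<omega>. \<exists>\<theta>'. is_mle \<Theta> \<mu> h T Xs N \<omega> \<theta>')"
    and mle_select: "\<And>N \<omega>. \<omega> \<in> space \<Omega> \<Longrightarrow> \<exists>\<theta>'. is_mle \<Theta> \<mu> h T Xs N \<omega> \<theta>' \<Longrightarrow>
      is_mle \<Theta> \<mu> h T Xs N \<omega> (\<theta>hat N \<omega>)"
    and mle_consistent: "\<And>\<theta>. \<theta> \<in> \<Theta> \<Longrightarrow> tendsto_in_prob (Q \<theta>) \<theta>hat \<theta>"
    and k_pos: "k > 0"
    and \<phi>_measurable: "\<phi> \<in> borel_measurable \<mu>"
    and \<phi>_bounded: "bounded (\<phi> ` space \<mu>)"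
    and \<phi>_smooth: "twice_differentiable_on (mean Q X \<phi>) \<Theta>"
    and P: "\<theta>\<^sub>P \<in> \<Theta>"
  shows "big_O_prob (Q \<theta>\<^sub>P)
    (\<lambda>N \<omega>. dr_expectation \<Theta> \<mu> h T Xs k N (\<lambda>\<theta> _. mean Q X \<phi> \<theta>) \<omega>
      - (mean Q X \<phi> (\<theta>hat N \<omega>)
         + k / (2 * real N) * asymp_var \<mu> h T Q X \<phi> (\<theta>hat N \<omega>)))
    (\<lambda>N. real N powr (- 3 / 2))"
proof -
  interpret exponential_family_sample \<Theta> \<mu> h T \<Omega> Q X Xs by (rule family)
  define m where "m = mean Q X \<phi>"
  obtain b where b: "\<And>x. x \<in> space \<mu> \<Longrightarrow> \<bar>\<phi> x\<bar> \<le> b"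
    using \<phi>_bounded unfolding bounded_iff by auto
  obtain m' where m': "has_partials m m'" "\<And>i. m' i \<in> smooth_algebra"
    using mean_partials[OF bounded_tame[OF \<phi>_measurable b]] unfolding m_def by blast
  obtain r c C K where pos: "0 < r" "0 < c" "0 \<le> C" "0 \<le> K" and local:
    "\<And>x u. dist \<theta>\<^sub>P x \<le> r \<Longrightarrow> norm u \<le> r \<Longrightarrow> x + u \<in> \<Theta>"
    "\<And>x u. dist \<theta>\<^sub>P x \<le> r \<Longrightarrow> norm u \<le> r \<Longrightarrow> \<bar>m (x + u) - m x - gradient m x \<bullet> u\<bar> \<le> C * (norm u)\<^sup>2"
    "\<And>x. dist \<theta>\<^sub>P x \<le> r \<Longrightarrow> norm (gradient m x) \<le> K"
    "\<And>x u. dist \<theta>\<^sub>P x \<le> r \<Longrightarrow> norm u \<le> r \<Longrightarrow>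
      \<bar>bregman x (x + u) - 1 / 2 * (u \<bullet> (hessian (log_partition \<mu> h T) x *v u))\<bar> \<le> C * norm u ^ 3"
    "\<And>x u. dist \<theta>\<^sub>P x \<le> r \<Longrightarrow> norm u \<le> r \<Longrightarrow> c * (norm u)\<^sup>2 \<le> bregman x (x + u)"
    "\<And>x y. dist \<theta>\<^sub>P x \<le> r \<Longrightarrow> y \<in> \<Theta> \<Longrightarrow> r < norm (y - x) \<Longrightarrow> c * r\<^sup>2 \<le> bregman x y"
    "\<And>x. dist \<theta>\<^sub>P x \<le> r \<Longrightarrow>
      transpose (hessian (log_partition \<mu> h T) x) = hessian (log_partition \<mu> h T) x"
    "\<And>x u. dist \<theta>\<^sub>P x \<le> r \<Longrightarrow>
      2 * c * (norm u)\<^sup>2 \<le> u \<bullet> (hessian (log_partition \<mu> h T) x *v u)"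
    using local_expansions[OF P info_pos[OF P] m'] by blast
  define R where "R = k * (K + C * r) / c"
  define E where "E = C * R\<^sup>2 + C * R ^ 3 / k"
  \<comment> \<open>The three bounds give \<open>n \<ge> 1\<close> and the two largeness conditions
    of \<open>penalized_sup_expansion\<close>.\<close>
  define N0 where "N0 = nat \<lceil>max 1 (max (R / r) (2 * b * k / (c * r\<^sup>2)))\<rceil>"
  have E: "E \<ge> 0" using pos k_pos by (simp add: E_def R_def)
  \<comment> \<open>Existence makes \<theta>hat a maximizer by \<open>mle_select\<close>,
    consistency puts it among the centres with common constants, and positivity of h excludes zero
    likelihoods.\<close>
  have "whp (Q \<theta>\<^sub>P) (\<lambda>N \<omega>. (\<exists>\<theta>'. is_mle \<Theta> \<mu> h T Xs N \<omega> \<theta>') \<and> dist (\<theta>hat N \<omega>) \<theta>\<^sub>P \<le> r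
      \<and> (\<forall>n. h (Xs n \<omega>) > 0))"
    by (intro whp_conj mle_exists P whp_dist_le[OF mle_consistent] pos whp_AE AE_h_positive)
  thus ?thesis
  proof (rule big_O_probI[where m = N0 and C = E])
    fix N \<omega>
    assume "N0 \<le> N" and \<omega>: "\<omega> \<in> space (Q \<theta>\<^sub>P)"
      and good: "(\<exists>\<theta>'. is_mle \<Theta> \<mu> h T Xs N \<omega> \<theta>') \<and> dist (\<theta>hat N \<omega>) \<theta>\<^sub>P \<le> r \<and> (\<forall>n. h (Xs n \<omega>) > 0)"
    define x where "x = \<theta>hat N \<omega>"
    define n where "n = real N"
    have "max 1 (max (R / r) (2 * b * k / (c * r\<^sup>2))) \<le> n"
      using \<open>N0 \<le> N\<close> unfolding N0_def n_def by linarith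
    hence n: "1 \<le> n" "R \<le> n * r" "2 * b * k \<le> n * (c * r\<^sup>2)"
      using pos by (simp_all add: pos_divide_le_eq)
    have x: "dist \<theta>\<^sub>P x \<le> r" using good by (simp add: x_def dist_commute)
    have mle: "is_mle \<Theta> \<mu> h T Xs N \<omega> x"
      unfolding x_def using good \<omega> space_Q[OF P] by (intro mle_select) auto
    define err where "err = dr_expectation \<Theta> \<mu> h T Xs k N (\<lambda>\<theta> _. m \<theta>) \<omega>
      - (m x + k / (2 * n) * asymp_var \<mu> h T Q X \<phi> x)"
    have m_bound: "\<And>y. y \<in> \<Theta> \<Longrightarrow> \<bar>m y\<bar> \<le> b"
      unfolding m_def by (rule mean_bounded[OF _ b \<phi>_measurable])
    have "0 < n" using n(1) by simp
    note penalized_sup_expansion[OF k_pos pos(2,1,3,4) this local(1)[OF x] m_bound local(2)[OF x]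
      local(3)[OF x] local(4)[OF x] local(5)[OF x] local(6)[OF x] local(7)[OF x] local(8)[OF x]
      n(2)[unfolded R_def] n(3)]
    moreover have "err = (SUP y\<in>\<Theta>. m y - n / k * bregman x y) - (m x + k / (2 * n) *
        (gradient m x \<bullet> (matrix_inv (hessian (log_partition \<mu> h T) x) *v gradient m x)))"
      using dr_expectation_eq_bregman[OF mle] good unfolding err_def asymp_var_def m_def n_def by simp
    ultimately have "\<bar>err\<bar> \<le> E / n\<^sup>2" unfolding E_def R_def by simp
    hence "\<bar>err\<bar> * n powr (3 / 2) \<le> E / n\<^sup>2 * n powr (3 / 2)" by (rule mult_right_mono) simp
    \<comment> \<open>The surplus half power is given away here, using
      \<open>n \<ge> 1\<close>.\<close>
    also have "\<dots> \<le> E / n\<^sup>2 * n powr 2" using n(1) E by (intro mult_left_mono powr_mono) auto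
    also have "\<dots> = E" using n(1) by simp
    finally have bound: "\<bar>err\<bar> * n powr (3 / 2) \<le> E" .
    have "n powr (- 3 / 2) = inverse (n powr (3 / 2))" using powr_minus[of n "3 / 2"] by simp
    hence "\<bar>err / n powr (- 3 / 2)\<bar> = \<bar>err\<bar> * n powr (3 / 2)"
      by (simp only: abs_mult divide_inverse inverse_inverse_eq abs_of_nonneg[OF powr_ge_zero])
    with bound have "\<bar>err / n powr (- 3 / 2)\<bar> \<le> E" by simp
    thus "\<bar>(dr_expectation \<Theta> \<mu> h T Xs k N (\<lambda>\<theta> _. mean Q X \<phi> \<theta>) \<omega>
        - (mean Q X \<phi> (\<theta>hat N \<omega>) + k / (2 * real N) * asymp_var \<mu> h T Q X \<phi> (\<theta>hat N \<omega>)))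
        / real N powr (- 3 / 2)\<bar> \<le> E"
      by (simp add: err_def m_def n_def x_def)
  qed
qed

end
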